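(* Consider the system $$\partial_t\rho_i+\mathrm{div}(\rho_iv)=0\ (i=1,\dots,n),\qquad \partial_t(\rho v)+\mathrm{div}(\rho v\otimes v+p\,\mathbb I)=0,$$ $$\partial_t\big(\rho e+\tfrac12\rho|v|^2\big)+\mathrm{div}\big((\rho e+\tfrac12\rho|v|^2)v+pv\big)=0,$$ written as $\nabla A(U)\partial_tU+\sum_{\alpha=1}^3\nabla F_\alpha(U)\partial_{x_\alpha}U=0$ with $U=(\rho_1,\dots,\rho_n,v_1,v_2,v_3,\theta)^\top$, $A(U)=(\rho_1,\dots,\rho_n,\rho v_1,\rho v_2,\rho v_3,\rho e+\tfrac12\rho|v|^2)^\top$ and $F_\alpha(U)=\big(\rho_1v_\alpha,\dots,\rho_nv_\alpha,\rho v_1v_\alpha+p\delta_{1\alpha},\rho v_2v_\alpha+p\delta_{2\alpha},\rho v_3v_\alpha+p\delta_{3\alpha},(\rho e+\tfrac12\rho|v|^2+p)v_\alpha\big)^\top$. Assume $\rho>0$, $\theta>0$, $c_v:=e_\theta(\rho_1,\dots,\rho_n,\theta)>0$ and that the matrix $\big((\rho\psi)_{\rho_i\rho_j}\big)_{i,j=1}^n$ is positive definite. Then the system is hyperbolic: for every unit vector $N=(N_1,N_2,N_3)$, the eigenvalue problem $$\Big[\sum_{\alpha=1}^3N_\alpha\nabla F_\alpha(U)-\lambda\nabla A(U)\Big]r=0$$ has characteristic equation $$\rho^4c_v(v\cdot N-\lambda)^{n+2}\Big((v\cdot N-\lambda)^2-\frac1\rho\sum_i\rho_ip_{\rho_i}-\frac{\theta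 p_\theta^2}{c_v\rho^2}\Big)=0,$$ so that all eigenvalues are real, namely $$\lambda_1=\dots=\lambda_{n+2}=v\cdot N,\qquad \lambda_{n+3},\lambda_{n+4}=v\cdot N\pm\sqrt{\frac1\rho\sum_i\rho_ip_{\rho_i}+\frac{\theta p_\theta^2}{c_v\rho^2}},$$ and the eigenspace corresponding to the repeated eigenvalue $v\cdot N$ has dimension $n+2$.
   Context: The fluid has $n$ components with mass densities $\rho_i\ge0$, common velocity $v=(v_1,v_2,v_3)$, common temperature $\theta$, and total mass $\rho=\sum_i\rho_i$. $\delta_{k\alpha}$ is the Kronecker delta. The Helmholtz free energy $\rho\psi=\rho\psi(\rho_1,\dots,\rho_n,\theta)$ is given (sufficiently smooth), and the entropy $\rho\eta$, internal energy $\rho e$, chemical potentials $\mu_i$ and total pressure $p$ are determined by $$(\rho\psi)_\theta=-\rho\eta,\quad \rho\psi=\rho e-\rho\eta\theta,\quad (\rho\psi)_{\rho_i}=\mu_i,\quad \rho\psi+p=\sum_i\rho_i\mu_i .$$ Subscripts $\rho_i,\theta$ denote partial derivatives in the variables $(\rho_1,\dots,\rho_n,\theta)$; $\nabla A$ and $\nabla F_\alpha$ are Jacobians with respect to $U$. *)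

theory Defs
  imports "HOL-Analysis.Analysis"
begin

section \<open>Derivatives\<close>

text \<open>The partial derivative with respect to a coordinate is \<open>dir_deriv\<close> along the corresponding
  standard unit vector.\<close>

definition dir_deriv ::
  "('a::real_normed_vector \<Rightarrow> 'b::real_normed_vector) \<Rightarrow> 'a \<Rightarrow> 'a \<Rightarrow> 'b" where
  "dir_deriv f d x = vector_derivative (\<lambda>s. f (x + s *\<^sub>R d)) (at 0)"

text \<open>\<open>Ck_on k D f\<close>: \<open>f\<close> is \<open>k\<close> times continuously differentiable on the open set \<open>D\<close>.\<close>

primrec Ck_on ::
  "nat \<Rightarrow> 'a::euclidean_space set \<Rightarrow> ('a \<Rightarrow> 'b::euclidean_space) \<Rightarrow> bool" where
  "Ck_on 0 D f \<longleftrightarrow> continuous_on D f"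
| "Ck_on (Suc k) D f \<longleftrightarrow>
     (\<forall>x\<in>D. f differentiable (at x)) \<and> (\<forall>d. Ck_on k D (\<lambda>x. frechet_derivative f (at x) d))"

text \<open>Symmetry is not part of the definition; it is automatic for the Hessian of a \<open>C\<^sup>2\<close> function.\<close>

definition positive_definite :: "real ^ 'n ^ 'n \<Rightarrow> bool" where
  "positive_definite M \<longleftrightarrow> (\<forall>x. x \<noteq> 0 \<longrightarrow> x \<bullet> (M *v x) > 0)"


section \<open>Hyperbolicity of first-order systems\<close>

text \<open>We consider systems \<open>\<partial>\<^sub>t A(U) + \<Sum>\<^sub>\<alpha> \<partial>\<^sub>\<alpha> F\<^sub>\<alpha>(U) = 0\<close> in three space dimensions.\<close>

definition normal_flux ::
  "(3 \<Rightarrow> real ^ 'm \<Rightarrow> real ^ 'm) \<Rightarrow> real ^ 'm \<Rightarrow> real ^ 3 \<Rightarrow> real ^ 'm ^ 'm" where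
  "normal_flux F U N = (\<Sum>\<alpha>\<in>UNIV. N $ \<alpha> *\<^sub>R jacobian (F \<alpha>) (at U))"

text \<open>The matrix \<open>\<Sum>\<^sub>\<alpha> N\<^sub>\<alpha> \<nabla>F\<^sub>\<alpha>(U) - \<lambda> \<nabla>A(U)\<close> for complex \<open>\<lambda>\<close>, so that reality of the eigenvalues is
  a genuine assertion.\<close>

definition pencil ::
  "(real ^ 'm \<Rightarrow> real ^ 'm) \<Rightarrow> (3 \<Rightarrow> real ^ 'm \<Rightarrow> real ^ 'm) \<Rightarrow> real ^ 'm \<Rightarrow> real ^ 3 \<Rightarrow> complex
     \<Rightarrow> complex ^ 'm ^ 'm" where
  "pencil A F U N l =
     (\<chi> i j. complex_of_real (normal_flux F U N $ i $ j)
              - l * complex_of_real (jacobian A (at U) $ i $ j))"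

definition is_eigenvalue ::
  "(real ^ 'm \<Rightarrow> real ^ 'm) \<Rightarrow> (3 \<Rightarrow> real ^ 'm \<Rightarrow> real ^ 'm) \<Rightarrow> real ^ 'm \<Rightarrow> real ^ 3 \<Rightarrow> complex
     \<Rightarrow> bool" where
  "is_eigenvalue A F U N l \<longleftrightarrow> (\<exists>r. r \<noteq> 0 \<and> pencil A F U N l *v r = 0)"

definition eigenspace ::
  "(real ^ 'm \<Rightarrow> real ^ 'm) \<Rightarrow> (3 \<Rightarrow> real ^ 'm \<Rightarrow> real ^ 'm) \<Rightarrow> real ^ 'm \<Rightarrow> real ^ 3 \<Rightarrow> real
     \<Rightarrow> (real ^ 'm) set" where
  "eigenspace A F U N l = {r. (normal_flux F U N - l *\<^sub>R jacobian A (at U)) *v r = 0}"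

text \<open>Hyperbolicity at the state \<open>U\<close>: \<open>\<nabla>A(U)\<close> is nonsingular and, for every unit vector \<open>N\<close>, all
  eigenvalues are real and there is a basis of eigenvectors.\<close>

definition hyperbolic_at ::
  "(real ^ 'm \<Rightarrow> real ^ 'm) \<Rightarrow> (3 \<Rightarrow> real ^ 'm \<Rightarrow> real ^ 'm) \<Rightarrow> real ^ 'm \<Rightarrow> bool" where
  "hyperbolic_at A F U \<longleftrightarrow>
     invertible (jacobian A (at U)) \<and>
     (\<forall>N. norm N = 1 \<longrightarrow>
        (\<forall>l. is_eigenvalue A F U N l \<longrightarrow> l \<in> \<real>) \<and>
        (\<exists>B. independent B \<and> span B = UNIV \<and> (\<forall>r\<in>B. \<exists>l. r \<in> eigenspace A F U N l)))"


section \<open>Thermodynamics of the mixture\<close>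

text \<open>The thermodynamic functions depend on \<open>(\<rho>\<^sub>1, \<dots>, \<rho>\<^sub>n, \<theta>)\<close>, a point of
  \<open>(real ^ 'n) \<times> real\<close> with \<open>n = CARD('n)\<close>. The argument \<open>\<Psi>\<close> is the Helmholtz free energy
  \<open>\<rho>\<psi>\<close>.\<close>

definition d_rho :: "'n::finite \<Rightarrow> ((real ^ 'n) \<times> real \<Rightarrow> real) \<Rightarrow> (real ^ 'n) \<times> real \<Rightarrow> real" where
  "d_rho i f = dir_deriv f (axis i 1, 0)"

definition d_theta :: "((real ^ ('n::finite)) \<times> real \<Rightarrow> real) \<Rightarrow> (real ^ 'n) \<times> real \<Rightarrow> real" where
  "d_theta f = dir_deriv f (0, 1)"

definition mass :: "real ^ ('n::finite) \<Rightarrow> real" where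
  "mass r = (\<Sum>i\<in>UNIV. r $ i)"

text \<open>\<open>entropy\<close> is \<open>\<rho>\<eta>\<close> and \<open>int_energy\<close> is \<open>\<rho>e\<close> (densities per volume), while
  \<open>spec_int_energy\<close> is \<open>e\<close>.\<close>

definition entropy :: "((real ^ ('n::finite)) \<times> real \<Rightarrow> real) \<Rightarrow> (real ^ 'n) \<times> real \<Rightarrow> real" where
  "entropy \<Psi> x = - d_theta \<Psi> x"

definition int_energy :: "((real ^ ('n::finite)) \<times> real \<Rightarrow> real) \<Rightarrow> (real ^ 'n) \<times> real \<Rightarrow> real" where
  "int_energy \<Psi> x = \<Psi> x + entropy \<Psi> x * snd x"

definition chem_pot :: "((real ^ ('n::finite)) \<times> real \<Rightarrow> real) \<Rightarrow> 'n \<Rightarrow> (real ^ 'n) \<times> real \<Rightarrow> real" where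
  "chem_pot \<Psi> i x = d_rho i \<Psi> x"

definition pressure :: "((real ^ ('n::finite)) \<times> real \<Rightarrow> real) \<Rightarrow> (real ^ 'n) \<times> real \<Rightarrow> real" where
  "pressure \<Psi> x = (\<Sum>i\<in>UNIV. fst x $ i * chem_pot \<Psi> i x) - \<Psi> x"

definition spec_int_energy :: "((real ^ ('n::finite)) \<times> real \<Rightarrow> real) \<Rightarrow> (real ^ 'n) \<times> real \<Rightarrow> real" where
  "spec_int_energy \<Psi> x = int_energy \<Psi> x / mass (fst x)"

definition heat_capacity :: "((real ^ ('n::finite)) \<times> real \<Rightarrow> real) \<Rightarrow> (real ^ 'n) \<times> real \<Rightarrow> real" where
  "heat_capacity \<Psi> = d_theta (spec_int_energy \<Psi>)"

definition rho_hessian ::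
  "((real ^ ('n::finite)) \<times> real \<Rightarrow> real) \<Rightarrow> (real ^ 'n) \<times> real \<Rightarrow> real ^ 'n ^ 'n" where
  "rho_hessian \<Psi> x = (\<chi> i j. d_rho j (d_rho i \<Psi>) x)"


section \<open>The multicomponent Euler system\<close>

text \<open>Vectors with \<open>n + 4\<close> entries: \<open>Inl i\<close> is the entry of species \<open>i\<close>, \<open>Inr (Inl k)\<close> the
  \<open>k\<close>-th velocity/momentum entry and \<open>Inr (Inr ())\<close> the temperature/energy entry.\<close>

type_synonym 'n state = "real ^ ('n + (3 + unit))"

definition stack :: "real ^ ('n::finite) \<Rightarrow> real ^ 3 \<Rightarrow> real \<Rightarrow> 'n state" where
  "stack r w s = (\<chi> a. case a of Inl i \<Rightarrow> r $ i | Inr (Inl k) \<Rightarrow> w $ k | Inr (Inr _) \<Rightarrow> s)"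

definition dens :: "('n::finite) state \<Rightarrow> real ^ 'n" where
  "dens U = (\<chi> i. U $ Inl i)"

definition vel :: "('n::finite) state \<Rightarrow> real ^ 3" where
  "vel U = (\<chi> k. U $ Inr (Inl k))"

definition temp :: "('n::finite) state \<Rightarrow> real" where
  "temp U = U $ Inr (Inr ())"

definition thermo :: "('n::finite) state \<Rightarrow> (real ^ 'n) \<times> real" where
  "thermo U = (dens U, temp U)"

definition total_energy :: "((real ^ ('n::finite)) \<times> real \<Rightarrow> real) \<Rightarrow> 'n state \<Rightarrow> real" where
  "total_energy \<Psi> U = int_energy \<Psi> (thermo U) + 1 / 2 * mass (dens U) * (norm (vel U))\<^sup>2"

definition kdelta :: "'k \<Rightarrow> 'k \<Rightarrow> real" where
  "kdelta k l = (if k = l then 1 else 0)"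

definition A_map :: "((real ^ ('n::finite)) \<times> real \<Rightarrow> real) \<Rightarrow> 'n state \<Rightarrow> 'n state" where
  "A_map \<Psi> U = stack (dens U) (mass (dens U) *\<^sub>R vel U) (total_energy \<Psi> U)"

definition F_map :: "((real ^ ('n::finite)) \<times> real \<Rightarrow> real) \<Rightarrow> 3 \<Rightarrow> 'n state \<Rightarrow> 'n state" where
  "F_map \<Psi> \<alpha> U =
     stack (\<chi> i. dens U $ i * vel U $ \<alpha>)
           (\<chi> k. mass (dens U) * vel U $ k * vel U $ \<alpha> + pressure \<Psi> (thermo U) * kdelta k \<alpha>)
           ((total_energy \<Psi> U + pressure \<Psi> (thermo U)) * vel U $ \<alpha>)"

text \<open>Fields depend on \<open>z = (t, x)\<close> in \<open>real \<times> (real ^ 3)\<close>.\<close>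

definition d_t :: "(real \<times> (real ^ 3) \<Rightarrow> 'b::real_normed_vector) \<Rightarrow> real \<times> (real ^ 3) \<Rightarrow> 'b" where
  "d_t f = dir_deriv f (1, 0)"

definition d_x :: "3 \<Rightarrow> (real \<times> (real ^ 3) \<Rightarrow> 'b::real_normed_vector) \<Rightarrow> real \<times> (real ^ 3) \<Rightarrow> 'b" where
  "d_x \<alpha> f = dir_deriv f (0, axis \<alpha> 1)"

text \<open>The balances of partial masses, momentum and total energy at the point \<open>z\<close>; the divergence of
  a tensor is taken row by row.\<close>

definition balance_laws_at ::
  "((real ^ ('n::finite)) \<times> real \<Rightarrow> real) \<Rightarrow> (real \<times> (real ^ 3) \<Rightarrow> 'n state) \<Rightarrow> real \<times> (real ^ 3) \<Rightarrow> bool"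
  where
  "balance_laws_at \<Psi> W z \<longleftrightarrow>
     (\<forall>i. d_t (\<lambda>y. dens (W y) $ i) z
          + (\<Sum>\<alpha>\<in>UNIV. d_x \<alpha> (\<lambda>y. dens (W y) $ i * vel (W y) $ \<alpha>) z) = 0) \<and>
     (\<forall>k. d_t (\<lambda>y. mass (dens (W y)) * vel (W y) $ k) z
          + (\<Sum>\<alpha>\<in>UNIV. d_x \<alpha> (\<lambda>y. mass (dens (W y)) * vel (W y) $ k * vel (W y) $ \<alpha>
                                  + pressure \<Psi> (thermo (W y)) * kdelta k \<alpha>) z) = 0) \<and>
     d_t (\<lambda>y. total_energy \<Psi> (W y)) z
       + (\<Sum>\<alpha>\<in>UNIV. d_x \<alpha> (\<lambda>y. total_energy \<Psi> (W y) * vel (W y) $ \<alpha>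
                               + pressure \<Psi> (thermo (W y)) * vel (W y) $ \<alpha>) z) = 0"

definition quasilinear_at ::
  "(real ^ 'm \<Rightarrow> real ^ 'm) \<Rightarrow> (3 \<Rightarrow> real ^ 'm \<Rightarrow> real ^ 'm)
     \<Rightarrow> (real \<times> (real ^ 3) \<Rightarrow> real ^ 'm) \<Rightarrow> real \<times> (real ^ 3) \<Rightarrow> bool" where
  "quasilinear_at A F W z \<longleftrightarrow>
     jacobian A (at (W z)) *v d_t W z
       + (\<Sum>\<alpha>\<in>UNIV. jacobian (F \<alpha>) (at (W z)) *v d_x \<alpha> W z) = 0"

definition sound_speed_sq :: "((real ^ ('n::finite)) \<times> real \<Rightarrow> real) \<Rightarrow> 'n state \<Rightarrow> real" where
  "sound_speed_sq \<Psi> U =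
     1 / mass (dens U) * (\<Sum>i\<in>UNIV. dens U $ i * d_rho i (pressure \<Psi>) (thermo U))
     + temp U * (d_theta (pressure \<Psi>) (thermo U))\<^sup>2
         / (heat_capacity \<Psi> (thermo U) * (mass (dens U))\<^sup>2)"

end

theory Submission
  imports Defs
begin

text \<open>
  The convective part of the system can be split off. Since \<open>F\<^sub>\<alpha> = v\<^sub>\<alpha> A + p (0, e\<^sub>\<alpha>, v\<^sub>\<alpha>)\<close>, with \<open>e\<^sub>\<alpha>\<close>
  the unit vectors, the normal flux Jacobian is
  \<open>\<nabla>A (v \<bullet> N + K)\<close>, where \<open>K\<close> has rank two: its two terms record the effect of a perturbation through
  \<open>\<delta>v \<bullet> N\<close> and through \<open>\<delta>p\<close> alone (\<open>normal_flux_factorization\<close>). Hence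
  \<open>\<Sum>\<^sub>\<alpha> N\<^sub>\<alpha> \<nabla>F\<^sub>\<alpha> - \<lambda> \<nabla>A = \<nabla>A (\<mu> + K)\<close> with \<open>\<mu> = v \<bullet> N - \<lambda>\<close>.

  Writing \<open>K = b1 c1\<^sup>T + b2 c2\<^sup>T\<close>, one finds \<open>c1 \<bullet> b1 = 0 = c2 \<bullet> b2\<close>, while \<open>(c1 \<bullet> b2) (c2 \<bullet> b1)\<close> is the
  squared sound speed. So \<open>det (\<mu> + K) = \<mu>\<^sup>n\<^sup>+\<^sup>2 (\<mu>\<^sup>2 - c\<^sup>2)\<close> by the matrix determinant lemma
  (\<open>det_mat_add_outer_outer\<close>), the kernel of \<open>K\<close> has codimension two, and together with the two
  acoustic eigenvectors it spans the space (locale \<open>rank_two_flux\<close>). The factor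
  \<open>det \<nabla>A = \<rho>\<^sup>3 (\<rho>e)\<^sub>\<theta> = \<rho>\<^sup>4 c\<^sub>v\<close> comes from a triangular structure (\<open>det_jacobian_A_map\<close>).

  Two thermodynamic identities shape the spectrum (\<open>mixture_derivatives\<close>). The Gibbs-Duhem relation,
  through the symmetry of second derivatives, yields the vector \<open>b1\<close>. The identity
  \<open>\<Sum>\<^sub>j \<rho>\<^sub>j p\<^bsub>\<rho>\<^sub>j\<^esub> = \<Sum>\<^sub>i\<^sub>j (\<rho>\<psi>)\<^bsub>\<rho>\<^sub>i\<rho>\<^sub>j\<^esub> \<rho>\<^sub>i \<rho>\<^sub>j\<close> makes the squared sound speed positive, so that the acoustic
  eigenvalues are real and different from \<open>v \<bullet> N\<close>.
\<close>

section \<open>Determinants of triangular matrices and low-rank updates\<close>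

text \<open>The height \<open>h\<close> replaces a linear order on the index type. If every factor of the Leibniz term of
  a permutation \<open>p\<close> is nonzero, then \<open>p\<close> strictly lowers the height wherever it moves an index, while it
  preserves the total height; so \<open>p = id\<close>.\<close>

lemma det_triangular_height:
  fixes M :: "'a::comm_ring_1 ^ 'n ^ 'n" and h :: "'n \<Rightarrow> nat"
  assumes tri: "\<And>i j. M $ i $ j \<noteq> 0 \<Longrightarrow> i = j \<or> h j < h i"
  shows "det M = (\<Prod>i\<in>UNIV. M $ i $ i)"
proof -
  have zero: "(\<Prod>i\<in>UNIV. M $ i $ p i) = 0" if p: "p permutes UNIV" and "p \<noteq> id" for p
  proof (rule ccontr)
    assume "(\<Prod>i\<in>UNIV. M $ i $ p i) \<noteq> 0"
    then have "M $ i $ p i \<noteq> 0" for i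
      by (metis UNIV_I finite prod_zero)
    then have step: "p i = i \<or> h (p i) < h i" for i
      using tri by metis
    obtain k where "p k \<noteq> k"
      using \<open>p \<noteq> id\<close> by fastforce
    then have "(\<Sum>i\<in>UNIV. h (p i)) < (\<Sum>i\<in>UNIV. h i)"
      using step by (intro sum_strict_mono_ex1) (auto intro: less_imp_le le_refl, metis le_refl less_imp_le)
    moreover have "(\<Sum>i\<in>UNIV. h (p i)) = (\<Sum>i\<in>UNIV. h i)"
      using sum.permute[OF p, of h] by (simp add: o_def)
    ultimately show False by simp
  qed
  have "det M = (\<Sum>p\<in>{id}. of_int (sign p) * (\<Prod>i\<in>UNIV. M $ i $ p i))"
    unfolding det_def
    by (rule sum.mono_neutral_right) (auto simp: zero permutes_id)
  then show ?thesis by (simp add: sign_id)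
qed

definition outer :: "'a::times ^ 'm \<Rightarrow> 'a ^ 'n \<Rightarrow> 'a ^ 'n ^ 'm" where
  "outer b c = (\<chi> i j. b $ i * c $ j)"

lemma distrib_right_matrix: "(A + B) ** C = A ** C + B ** C"
  for A B :: "'a::semiring_1 ^ 'n ^ 'm"
  by (vector matrix_matrix_mult_def sum.distrib[symmetric] field_simps)

lemma matrix_mult_outer: "A ** outer b c = outer (A *v b) c"
  for A :: "'a::comm_semiring_1 ^ 'n ^ 'm"
  by (simp add: outer_def matrix_matrix_mult_def matrix_vector_mult_def vec_eq_iff
      sum_distrib_right mult.assoc)

lemma outer_mult_matrix: "outer b c ** A = outer b (c v* A)"
  for A :: "'a::comm_semiring_1 ^ 'n ^ 'm"
  by (simp add: outer_def matrix_matrix_mult_def vector_matrix_mult_def vec_eq_iff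
      sum_distrib_left mult_ac)

lemma outer_mult_vec: "outer b c *v x = (\<Sum>j\<in>UNIV. c $ j * x $ j) *s b"
  for b :: "'a::comm_semiring_1 ^ 'm"
  by (simp add: outer_def matrix_vector_mult_def vec_eq_iff sum_distrib_left
      sum_distrib_right mult_ac)

text \<open>The matrix determinant lemma. When \<open>v\<close> is a standard basis vector, the update changes a single column of
  the identity, and Cramer's rule applies. In general, a nonzero \<open>v\<close> is row \<open>k\<close> of the matrix \<open>S\<close> below, and \<open>S\<close>
  intertwines the update along \<open>v\<close> with one along \<open>axis k 1\<close>.\<close>

lemma det_mat_1_add_outer:
  fixes u v :: "'a::field ^ 'n"
  shows "det (mat 1 + outer u v) = 1 + (\<Sum>j\<in>UNIV. v $ j * u $ j)"
proof (cases "v = 0")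
  case True
  then have "outer u v = 0" by (simp add: outer_def vec_eq_iff)
  with True show ?thesis by simp
next
  case False
  then obtain k where k: "v $ k \<noteq> 0" by (auto simp: vec_eq_iff)
  have col: "det (\<chi> i j. if j = k then x $ i else (mat 1 :: 'a^'n^'n) $ i $ j) = x $ k" for x :: "'a^'n"
    using cramer_lemma[of k "mat 1" x] by (simp cong: if_cong)
  define S :: "'a ^ 'n ^ 'n" where "S = (\<chi> i j. if i = k then v $ j else mat 1 $ i $ j)"
  have "transpose S = (\<chi> i j. if j = k then v $ i else (mat 1 :: 'a^'n^'n) $ i $ j)"
    by (auto simp: S_def transpose_def vec_eq_iff mat_def)
  then have detS: "det S = v $ k"
    using det_transpose[of S] by (simp only: col)
  have unit: "det (mat 1 + outer w (axis k 1)) = 1 + w $ k" for w :: "'a ^ 'n"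
  proof -
    have "mat 1 + outer w (axis k 1)
        = (\<chi> i j. if j = k then (axis k 1 + w) $ i else (mat 1 :: 'a^'n^'n) $ i $ j)"
      by (auto simp: outer_def vec_eq_iff mat_def axis_def)
    then show ?thesis by (simp only: col) simp
  qed
  have rowk: "axis k 1 v* S = v"
    by (simp add: S_def vector_matrix_mult_def vec_eq_iff axis_def if_distrib[of "\<lambda>x. x * _"] if_distrib[of "\<lambda>x. _ * x"] cong: if_cong)
  \<comment> \<open>Instead of conjugating by \<open>S\<close>, compare both sides after multiplication by \<open>S\<close>: no inverse matrix has to be named.\<close>
  have "S ** (mat 1 + outer u v) = (mat 1 + outer (S *v u) (axis k 1)) ** S"
    by (simp add: matrix_add_ldistrib distrib_right_matrix matrix_mult_outer outer_mult_matrix rowk)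
  then have "det S * det (mat 1 + outer u v) = (1 + (S *v u) $ k) * det S"
    by (metis det_mul unit)
  moreover have "(S *v u) $ k = (\<Sum>j\<in>UNIV. v $ j * u $ j)"
    by (simp add: S_def matrix_vector_mult_def)
  ultimately show ?thesis using detS k by simp
qed

lemma mat_mult_vec: "mat m *v x = m *s x"
  for x :: "'a::comm_semiring_1 ^ 'n"
  by (simp add: vec_eq_iff mat_def matrix_vector_mult_def if_distrib[of "\<lambda>x. x * _"] cong: if_cong)

lemma det_mat_add_outer:
  fixes u v :: "'a::field ^ 'n"
  assumes "m \<noteq> 0"
  shows "det (mat m + outer u v) = m ^ CARD('n) * (1 + (\<Sum>j\<in>UNIV. v $ j * u $ j) / m)"
proof -
  have "mat m + outer u v = mat m ** (mat 1 + outer ((1/m) *s u) v)"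
    using assms by (simp add: matrix_add_ldistrib matrix_mult_outer mat_mult_vec)
  moreover have "det (mat m :: 'a^'n^'n) = m ^ CARD('n)"
    by (subst det_diagonal) (auto simp: mat_def)
  ultimately show ?thesis
    by (simp add: det_mul det_mat_1_add_outer sum_divide_distrib)
qed

text \<open>The rank-two update factors as \<open>(mat m + outer b1 c1) ** (mat 1 + outer u c2)\<close>, where \<open>u\<close> solves
  \<open>(mat m + outer b1 c1) *v u = b2\<close>; because \<open>c1\<close> annihilates \<open>b1\<close>, the solution is explicit. The
  factor \<open>m\<^sup>2\<close> on the left avoids division.\<close>

lemma det_mat_add_outer_outer_nonzero:
  fixes b1 b2 c1 c2 :: "'a::field ^ 'n"
  assumes m: "m \<noteq> 0"
    and "(\<Sum>j\<in>UNIV. c1 $ j * b1 $ j) = 0" and "(\<Sum>j\<in>UNIV. c2 $ j * b2 $ j) = 0"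
  shows "m\<^sup>2 * det (mat m + (outer b1 c1 + outer b2 c2))
    = m ^ CARD('n) * (m\<^sup>2 - (\<Sum>j\<in>UNIV. c1 $ j * b2 $ j) * (\<Sum>j\<in>UNIV. c2 $ j * b1 $ j))"
proof -
  define s where "s = (\<Sum>j\<in>UNIV. c1 $ j * b2 $ j)"
  define t where "t = (\<Sum>j\<in>UNIV. c2 $ j * b1 $ j)"
  define u where "u = (1/m) *s b2 - (s / m\<^sup>2) *s b1"
  have c1u: "(\<Sum>j\<in>UNIV. c1 $ j * u $ j) = s / m"
  proof -
    have "(\<Sum>j\<in>UNIV. c1 $ j * u $ j)
        = (1/m) * (\<Sum>j\<in>UNIV. c1 $ j * b2 $ j) - (s / m\<^sup>2) * (\<Sum>j\<in>UNIV. c1 $ j * b1 $ j)"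
      by (simp add: u_def sum_subtractf sum_distrib_left algebra_simps)
    then show ?thesis using assms by (simp add: s_def)
  qed
  have c2u: "(\<Sum>j\<in>UNIV. c2 $ j * u $ j) = - (s * t / m\<^sup>2)"
  proof -
    have "(\<Sum>j\<in>UNIV. c2 $ j * u $ j)
        = (1/m) * (\<Sum>j\<in>UNIV. c2 $ j * b2 $ j) - (s / m\<^sup>2) * (\<Sum>j\<in>UNIV. c2 $ j * b1 $ j)"
      by (simp add: u_def sum_subtractf sum_distrib_left algebra_simps)
    then show ?thesis using assms by (simp add: t_def)
  qed
  have "(mat m + outer b1 c1) *v u = m *s u + (s / m) *s b1"
    by (simp add: matrix_vector_mult_add_rdistrib outer_mult_vec c1u mat_mult_vec)
  also have "\<dots> = b2"
    using m by (simp add: u_def vec_eq_iff field_simps power2_eq_square)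
  finally have "(mat m + outer b1 c1) ** (mat 1 + outer u c2) = mat m + (outer b1 c1 + outer b2 c2)"
    by (simp add: matrix_add_ldistrib matrix_mult_outer add.assoc)
  then have "det (mat m + (outer b1 c1 + outer b2 c2))
      = det (mat m + outer b1 c1) * det (mat 1 + outer u c2)"
    by (metis det_mul)
  also have "\<dots> = m ^ CARD('n) * (1 - s * t / m\<^sup>2)"
    using m assms by (simp add: det_mat_add_outer det_mat_1_add_outer c2u)
  finally show ?thesis
    using m by (simp add: field_simps s_def t_def)
qed

text \<open>Both sides are polynomials in \<open>m\<close> that agree for \<open>m \<noteq> 0\<close>, hence also at \<open>m = 0\<close>, by continuity.
  The value at \<open>m = 0\<close> is what makes the characteristic equation an identity at the repeated
  eigenvalue as well.\<close>

lemma det_mat_add_outer_outer: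
  fixes b1 b2 c1 c2 :: "'a::real_normed_field ^ 'n"
  assumes card: "CARD('n) = d + 2"
    and "(\<Sum>j\<in>UNIV. c1 $ j * b1 $ j) = 0" and "(\<Sum>j\<in>UNIV. c2 $ j * b2 $ j) = 0"
  shows "det (mat m + (outer b1 c1 + outer b2 c2))
    = m ^ d * (m\<^sup>2 - (\<Sum>j\<in>UNIV. c1 $ j * b2 $ j) * (\<Sum>j\<in>UNIV. c2 $ j * b1 $ j))"
    (is "?L m = _ * (_ - ?st)")
proof -
  let ?R = "\<lambda>m. m ^ d * (m\<^sup>2 - ?st)"
  have eq: "?L x = ?R x" if "x \<noteq> 0" for x
  proof -
    have "x\<^sup>2 * ?L x = x ^ (d + 2) * (x\<^sup>2 - ?st)"
      using det_mat_add_outer_outer_nonzero[OF that assms(2,3)] by (simp only: card)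
    also have "\<dots> = x\<^sup>2 * ?R x"
      by (simp only: power_add mult.commute[of "x ^ d"] mult.assoc)
    finally have *: "x\<^sup>2 * ?L x = x\<^sup>2 * ?R x" .
    have "x\<^sup>2 \<noteq> 0" using that by simp
    from mult_left_cancel[OF this] * show ?thesis by blast
  qed
  have "isCont (\<lambda>m :: 'a. (mat m :: 'a ^ 'n ^ 'n) $ i $ j) 0" for i j :: 'n
    by (cases "i = j") (simp_all add: mat_def)
  then have "isCont ?L 0"
    unfolding det_def vector_add_component
    by (intro continuous_sum continuous_prod continuous_mult continuous_add continuous_const)
  then have "(?L \<longlongrightarrow> ?L 0) (at 0)"
    by (simp only: isCont_def)
  moreover have "isCont ?R 0"
    by (intro continuous_intros)
  then have "(?R \<longlongrightarrow> ?R 0) (at 0)"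
    by (simp only: isCont_def)
  moreover have "(?L \<longlongrightarrow> ?L 0) (at 0) = (?R \<longlongrightarrow> ?L 0) (at 0)"
    by (intro filterlim_cong refl) (simp add: eventually_at_filter eq)
  ultimately have "?L 0 = ?R 0"
    using LIM_unique by blast
  with eq show ?thesis by (cases "m = 0") auto
qed

section \<open>Symmetry of second derivatives\<close>

text \<open>The mean value theorem, applied first along \<open>d\<close> to the increment of \<open>f\<close> in direction \<open>e\<close>, then
  along \<open>e\<close>. The second difference on the left is symmetric in \<open>d\<close> and \<open>e\<close>, the right-hand side is not.\<close>

lemma second_difference_mvt:
  fixes f :: "'a::real_normed_vector \<Rightarrow> real"
  assumes t: "0 < t"
    and f: "\<And>a b. \<lbrakk>0 \<le> a; a \<le> t; 0 \<le> b; b \<le> t\<rbrakk> \<Longrightarrow>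
      (f has_derivative f' (x + a *\<^sub>R d + b *\<^sub>R e)) (at (x + a *\<^sub>R d + b *\<^sub>R e))"
    and g: "\<And>a b. \<lbrakk>0 \<le> a; a \<le> t; 0 \<le> b; b \<le> t\<rbrakk> \<Longrightarrow>
      ((\<lambda>y. f' y d) has_derivative g' (x + a *\<^sub>R d + b *\<^sub>R e)) (at (x + a *\<^sub>R d + b *\<^sub>R e))"
  shows "\<exists>a b. 0 \<le> a \<and> a \<le> t \<and> 0 \<le> b \<and> b \<le> t \<and>
    f (x + t *\<^sub>R d + t *\<^sub>R e) - f (x + t *\<^sub>R d) - f (x + t *\<^sub>R e) + f x
      = t\<^sup>2 * g' (x + a *\<^sub>R d + b *\<^sub>R e) e"
proof -
  have lin: "linear (f' (x + a *\<^sub>R d + b *\<^sub>R e))" "linear (g' (x + a *\<^sub>R d + b *\<^sub>R e))"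
    if "0 \<le> a" "a \<le> t" "0 \<le> b" "b \<le> t" for a b
    using f[OF that] g[OF that] by (auto intro: has_derivative_linear)
  have 1: "((\<lambda>a. f (x + a *\<^sub>R d + b *\<^sub>R e)) has_field_derivative f' (x + a *\<^sub>R d + b *\<^sub>R e) d) (at a)"
    if ab: "0 \<le> a" "a \<le> t" "0 \<le> b" "b \<le> t" for a b
  proof -
    have "((\<lambda>a. x + a *\<^sub>R d + b *\<^sub>R e) has_derivative (\<lambda>h. h *\<^sub>R d)) (at a)"
      by (auto intro!: derivative_eq_intros)
    from has_derivative_compose[OF this f[OF ab]] show ?thesis
      by (simp add: has_field_derivative_def linear_scale[OF lin(1)[OF ab]] mult_commute_abs)
  qed
  have 2: "((\<lambda>b. f' (x + a *\<^sub>R d + b *\<^sub>R e) d) has_field_derivative g' (x + a *\<^sub>R d + b *\<^sub>R e) e) (at b)"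
    if ab: "0 \<le> a" "a \<le> t" "0 \<le> b" "b \<le> t" for a b
  proof -
    have "((\<lambda>b. x + a *\<^sub>R d + b *\<^sub>R e) has_derivative (\<lambda>h. h *\<^sub>R e)) (at b)"
      by (auto intro!: derivative_eq_intros)
    from has_derivative_compose[OF this g[OF ab]] show ?thesis
      by (simp add: has_field_derivative_def linear_scale[OF lin(2)[OF ab]] mult_commute_abs)
  qed
  have "\<exists>a>0. a < t \<and>
      (f (x + t *\<^sub>R d + t *\<^sub>R e) - f (x + t *\<^sub>R d + 0 *\<^sub>R e))
      - (f (x + 0 *\<^sub>R d + t *\<^sub>R e) - f (x + 0 *\<^sub>R d + 0 *\<^sub>R e))
      = (t - 0) * (f' (x + a *\<^sub>R d + t *\<^sub>R e) d - f' (x + a *\<^sub>R d + 0 *\<^sub>R e) d)"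
    by (rule MVT2[OF t]) (intro DERIV_diff 1; use t in simp)
  then obtain a where a: "0 < a" "a < t" and eqa:
      "(f (x + t *\<^sub>R d + t *\<^sub>R e) - f (x + t *\<^sub>R d)) - (f (x + t *\<^sub>R e) - f x)
      = t * (f' (x + a *\<^sub>R d + t *\<^sub>R e) d - f' (x + a *\<^sub>R d + 0 *\<^sub>R e) d)"
    by auto
  have "\<exists>b>0. b < t \<and> f' (x + a *\<^sub>R d + t *\<^sub>R e) d - f' (x + a *\<^sub>R d + 0 *\<^sub>R e) d
      = (t - 0) * g' (x + a *\<^sub>R d + b *\<^sub>R e) e"
    by (rule MVT2[OF t]) (intro 2; use a in simp)
  then obtain b where "0 < b" "b < t" "f' (x + a *\<^sub>R d + t *\<^sub>R e) d - f' (x + a *\<^sub>R d + 0 *\<^sub>R e) d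
      = t * g' (x + a *\<^sub>R d + b *\<^sub>R e) e"
    by auto
  with a eqa show ?thesis
    by (intro exI[of _ a] exI[of _ b]) (auto simp: power2_eq_square algebra_simps)
qed

lemma Ck_on_2_derivatives:
  fixes f :: "'a::euclidean_space \<Rightarrow> real"
  assumes "Ck_on 2 D f"
  shows "\<And>x. x \<in> D \<Longrightarrow> (f has_derivative frechet_derivative f (at x)) (at x)"
    and "\<And>x d. x \<in> D \<Longrightarrow> ((\<lambda>y. frechet_derivative f (at y) d) has_derivative
           frechet_derivative (\<lambda>y. frechet_derivative f (at y) d) (at x)) (at x)"
    and "\<And>d e. continuous_on D (\<lambda>x. frechet_derivative (\<lambda>y. frechet_derivative f (at y) d) (at x) e)"
  using assms by (auto simp: numeral_2_eq_2 frechet_derivative_works[symmetric])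

text \<open>Schwarz's theorem. The same second difference is represented by a mixed derivative in either
  order at points arbitrarily close to \<open>x\<close>; continuity of both mixed derivatives identifies their
  values at \<open>x\<close>.\<close>

lemma Ck_on_2_mixed_derivatives_commute:
  fixes f :: "'a::euclidean_space \<Rightarrow> real"
  assumes "open D" and C2: "Ck_on 2 D f" and x: "x \<in> D"
  shows "frechet_derivative (\<lambda>y. frechet_derivative f (at y) d) (at x) e
       = frechet_derivative (\<lambda>y. frechet_derivative f (at y) e) (at x) d"
proof -
  define h where "h d e y = frechet_derivative (\<lambda>y. frechet_derivative f (at y) d) (at y) e" for d e y
  note der = Ck_on_2_derivatives[OF C2]
  have cont: "isCont (h d e) x" for d e
    using der(3)[of d e] \<open>open D\<close> x
    unfolding h_def by (metis (no_types, lifting) continuous_on_eq_continuous_at)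
  have "\<bar>h d e x - h e d x\<bar> \<le> \<epsilon>" if "\<epsilon> > 0" for \<epsilon>
  proof -
    have "eventually (\<lambda>y. y \<in> D) (nhds x)"
      using \<open>open D\<close> x by (rule eventually_nhds_in_open)
    moreover have "eventually (\<lambda>y. dist (h d e y) (h d e x) < \<epsilon>/2) (nhds x)"
        "eventually (\<lambda>y. dist (h e d y) (h e d x) < \<epsilon>/2) (nhds x)"
      using tendstoD[OF cont[unfolded isCont_def tendsto_at_iff_tendsto_nhds] half_gt_zero[OF that]]
      by blast+
    ultimately have "eventually (\<lambda>y. y \<in> D \<and> dist (h d e y) (h d e x) < \<epsilon>/2
        \<and> dist (h e d y) (h e d x) < \<epsilon>/2) (nhds x)"
      by eventually_elim auto
    then obtain r where r: "r > 0" and near: "\<And>y. dist y x < r \<Longrightarrow>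
        y \<in> D \<and> dist (h d e y) (h d e x) < \<epsilon>/2 \<and> dist (h e d y) (h e d x) < \<epsilon>/2"
      by (auto simp: eventually_nhds_metric)
    \<comment> \<open>Small enough that the parallelogram spanned by \<open>t d\<close> and \<open>t e\<close> at \<open>x\<close> stays in the ball of radius \<open>r\<close>.\<close>
    define t where "t = r / (norm d + norm e + 1)"
    have t: "0 < t"
      using r by (auto simp: t_def intro!: divide_pos_pos add_nonneg_pos)
    have tr: "t * (norm d + norm e) < r"
    proof -
      have "t * (norm d + norm e) < t * (norm d + norm e + 1)" using t by simp
      also have "\<dots> = r"
        using add_nonneg_pos[of "norm d + norm e" 1] by (simp add: t_def)
      finally show ?thesis .
    qed
    have close: "dist (x + a *\<^sub>R d + b *\<^sub>R e) x < r" if "0 \<le> a" "a \<le> t" "0 \<le> b" "b \<le> t" for a b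
    proof -
      have "dist (x + a *\<^sub>R d + b *\<^sub>R e) x = norm (a *\<^sub>R d + b *\<^sub>R e)"
        by (simp add: dist_norm add.assoc)
      also have "\<dots> \<le> a * norm d + b * norm e"
        using that by (intro order_trans[OF norm_triangle_ineq]) simp
      also have "\<dots> \<le> t * (norm d + norm e)"
        using that by (simp add: distrib_left add_mono mult_right_mono)
      finally show ?thesis using tr by simp
    qed
    have flip: "x + b *\<^sub>R e + a *\<^sub>R d = x + a *\<^sub>R d + b *\<^sub>R e" for a b by simp
    obtain a b where ab: "0 \<le> a" "a \<le> t" "0 \<le> b" "b \<le> t" and 1:
      "f (x + t *\<^sub>R d + t *\<^sub>R e) - f (x + t *\<^sub>R d) - f (x + t *\<^sub>R e) + f x
        = t\<^sup>2 * h d e (x + a *\<^sub>R d + b *\<^sub>R e)"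
      using second_difference_mvt[OF t der(1) der(2), of x d e] near close
      unfolding h_def by blast
    obtain a' b' where ab': "0 \<le> a'" "a' \<le> t" "0 \<le> b'" "b' \<le> t" and 2:
      "f (x + t *\<^sub>R e + t *\<^sub>R d) - f (x + t *\<^sub>R e) - f (x + t *\<^sub>R d) + f x
        = t\<^sup>2 * h e d (x + a' *\<^sub>R e + b' *\<^sub>R d)"
      using second_difference_mvt[OF t der(1) der(2), of x e d] near close
      unfolding h_def flip by blast
    have "h d e (x + a *\<^sub>R d + b *\<^sub>R e) = h e d (x + b' *\<^sub>R d + a' *\<^sub>R e)"
    proof -
      have "t\<^sup>2 * h d e (x + a *\<^sub>R d + b *\<^sub>R e) = t\<^sup>2 * h e d (x + b' *\<^sub>R d + a' *\<^sub>R e)"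
        using 1 2 unfolding flip by linarith
      with t show ?thesis by simp
    qed
    then show ?thesis
      using near[OF close[OF ab]] near[OF close[OF ab'(3,4,1,2)]]
      by (simp add: dist_real_def abs_if split: if_splits)
  qed
  then have "h d e x = h e d x"
    by (metis abs_le_zero_iff dense_ge eq_iff_diff_eq_0)
  then show ?thesis by (simp add: h_def)
qed

section \<open>Spectrum of a rank-two perturbation of convection\<close>

definition cmat :: "real ^ 'n ^ 'm \<Rightarrow> complex ^ 'n ^ 'm" where
  "cmat M = (\<chi> i j. complex_of_real (M $ i $ j))"

definition cvec :: "real ^ 'n \<Rightarrow> complex ^ 'n" where
  "cvec x = (\<chi> i. complex_of_real (x $ i))"

lemma cmat_mult: "cmat (A ** B) = cmat A ** cmat B"
  by (simp add: cmat_def matrix_matrix_mult_def vec_eq_iff)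

lemma cmat_add: "cmat (A + B) = cmat A + cmat B"
  by (simp add: cmat_def vec_eq_iff)

lemma cmat_mat: "cmat (mat m) = mat (complex_of_real m)"
  by (simp add: cmat_def mat_def vec_eq_iff)

lemma cmat_outer: "cmat (outer b c) = outer (cvec b) (cvec c)"
  by (simp add: cmat_def cvec_def outer_def vec_eq_iff)

lemma det_cmat: "det (cmat A) = complex_of_real (det A)"
  by (simp add: cmat_def det_def)

lemma cvec_dot: "(\<Sum>j\<in>UNIV. cvec x $ j * cvec y $ j) = complex_of_real (x \<bullet> y)"
  by (simp add: cvec_def inner_vec_def)

lemma det_eq_0_iff_kernel: "det A = 0 \<longleftrightarrow> (\<exists>x. x \<noteq> 0 \<and> A *v x = 0)"
  for A :: "'a::field ^ 'n ^ 'n"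
proof -
  have "det A \<noteq> 0 \<longleftrightarrow> (\<forall>x. A *v x = 0 \<longrightarrow> x = 0)"
    by (simp only: invertible_det_nz[symmetric] invertible_left_inverse matrix_left_invertible_ker)
  then show ?thesis by blast
qed

text \<open>With \<open>u = v \<bullet> N\<close>, the normal flux Jacobian is \<open>J (u + K)\<close>, where \<open>J = \<nabla>A\<close> and
  \<open>K = b1 c1\<^sup>T + b2 c2\<^sup>T\<close>. Since \<open>c1\<close> kills \<open>b1\<close> and \<open>c2\<close> kills \<open>b2\<close>, the map \<open>K\<close> interchanges the
  lines through \<open>b1\<close> and \<open>b2\<close>, so that its nonzero eigenvalues are the square roots of \<open>\<kappa>\<close>.\<close>

locale rank_two_flux =
  fixes A :: "real ^ 'm \<Rightarrow> real ^ 'm" and F :: "3 \<Rightarrow> real ^ 'm \<Rightarrow> real ^ 'm"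
    and U :: "real ^ 'm" and N :: "real ^ 3" and u \<kappa> :: real
    and b1 b2 c1 c2 :: "real ^ 'm" and d :: nat
  assumes det_A: "det (jacobian A (at U)) \<noteq> 0"
    and flux: "normal_flux F U N = jacobian A (at U) ** (mat u + (outer b1 c1 + outer b2 c2))"
    and c1_b1: "c1 \<bullet> b1 = 0" and c2_b2: "c2 \<bullet> b2 = 0"
    and \<kappa>: "(c1 \<bullet> b2) * (c2 \<bullet> b1) = \<kappa>" and \<kappa>_pos: "\<kappa> > 0"
    and card: "CARD('m) = d + 2"
begin

lemma det_pencil:
  "det (pencil A F U N l)
    = of_real (det (jacobian A (at U))) * (of_real u - l) ^ d * ((of_real u - l)\<^sup>2 - of_real \<kappa>)"
proof -
  let ?J = "jacobian A (at U)"
  let ?K = "outer b1 c1 + outer b2 c2"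
  have "pencil A F U N l = cmat (normal_flux F U N) + cmat ?J ** mat (- l)"
    by (simp add: pencil_def cmat_def vec_eq_iff matrix_matrix_mult_def mat_def
        if_distrib[of "\<lambda>x. _ * x"] cong: if_cong)
  also have "\<dots> = cmat ?J ** (cmat (mat u + ?K) + mat (- l))"
    by (simp only: flux cmat_mult matrix_add_ldistrib[of "cmat ?J"])
  also have "cmat (mat u + ?K) + mat (- l)
      = mat (of_real u - l) + (outer (cvec b1) (cvec c1) + outer (cvec b2) (cvec c2))"
    by (simp add: cmat_add cmat_mat cmat_outer) (simp add: vec_eq_iff mat_def)
  finally have "det (pencil A F U N l) = det (cmat ?J)
      * det (mat (of_real u - l) + (outer (cvec b1) (cvec c1) + outer (cvec b2) (cvec c2)))"
    by (simp only: det_mul)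
  also have "det (mat (of_real u - l) + (outer (cvec b1) (cvec c1) + outer (cvec b2) (cvec c2)))
      = (of_real u - l) ^ d * ((of_real u - l)\<^sup>2 - of_real \<kappa>)"
    using det_mat_add_outer_outer[OF card, of "cvec c1" "cvec b1" "cvec c2" "cvec b2"] c1_b1 c2_b2
    by (simp only: cvec_dot of_real_0 \<kappa>[symmetric] of_real_mult)
  finally show ?thesis by (simp only: det_cmat mult.assoc)
qed

lemma eigenspace_eq:
  "r \<in> eigenspace A F U N l \<longleftrightarrow> (u - l) *\<^sub>R r + (c1 \<bullet> r) *\<^sub>R b1 + (c2 \<bullet> r) *\<^sub>R b2 = 0"
proof -
  let ?J = "jacobian A (at U)"
  have dot: "outer b c *v r = (c \<bullet> r) *\<^sub>R b" for b c :: "real ^ 'm"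
    by (simp add: outer_mult_vec inner_vec_def scalar_mult_eq_scaleR)
  have "(normal_flux F U N - l *\<^sub>R ?J) *v r
      = ?J *v ((u - l) *\<^sub>R r + (c1 \<bullet> r) *\<^sub>R b1 + (c2 \<bullet> r) *\<^sub>R b2)"
    by (simp add: flux matrix_vector_mult_diff_rdistrib matrix_vector_mult_add_rdistrib
        matrix_vector_mul_assoc[symmetric] mat_mult_vec dot matrix_vector_right_distrib
        matrix_vector_mult_diff_distrib matrix_vector_mult_scaleR scalar_mult_eq_scaleR scaleR_matrix_vector_assoc[symmetric]
        scaleR_left_diff_distrib)
  moreover have "?J *v w = 0 \<longleftrightarrow> w = 0" for w
    using det_A det_eq_0_iff_kernel[of ?J] by (metis matrix_vector_mult_0_right)
  ultimately show ?thesis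
    by (simp only: eigenspace_def mem_Collect_eq)
qed

lemma dots_nonzero: "c1 \<bullet> b2 \<noteq> 0" "c2 \<bullet> b1 \<noteq> 0"
  using \<kappa> \<kappa>_pos by auto

lemma eigenspace_u: "eigenspace A F U N u = {r. c1 \<bullet> r = 0 \<and> c2 \<bullet> r = 0}"
proof -
  have "c1 \<bullet> r = 0 \<and> c2 \<bullet> r = 0" if eq: "(c1 \<bullet> r) *\<^sub>R b1 + (c2 \<bullet> r) *\<^sub>R b2 = 0" for r
  proof -
    have "(c2 \<bullet> r) * (c1 \<bullet> b2) = 0" "(c1 \<bullet> r) * (c2 \<bullet> b1) = 0"
      using arg_cong[OF eq, of "inner c1"] arg_cong[OF eq, of "inner c2"] c1_b1 c2_b2
      by (simp_all add: inner_add_right)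
    with dots_nonzero show ?thesis by simp
  qed
  then show ?thesis by (auto simp: eigenspace_eq)
qed

text \<open>The eigenspace is the orthogonal complement of the plane spanned by \<open>c1\<close> and \<open>c2\<close>, which
  are not parallel because \<open>b2\<close> is annihilated by \<open>c2\<close> but not by \<open>c1\<close>.\<close>

lemma dim_eigenspace_u: "dim (eigenspace A F U N u) = d"
proof -
  have "c2 \<noteq> 0" using dots_nonzero(2) by (metis inner_zero_left)
  have c1: "c1 \<notin> span {c2}"
  proof
    assume "c1 \<in> span {c2}"
    then obtain k where "c1 = k *\<^sub>R c2" unfolding span_singleton by blast
    then have "c1 \<bullet> b2 = 0" using c2_b2 by simp
    then show False using dots_nonzero by blast
  qed
  then have "independent {c1, c2}"
    using \<open>c2 \<noteq> 0\<close> by (intro independent_insertI) (simp_all add: independent_empty)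
  moreover have "c1 \<noteq> c2"
    using c1_b1 dots_nonzero by metis
  ultimately have two: "dim (span {c1, c2}) = 2"
    by (simp add: dim_eq_card_independent)
  have "dim {y \<in> UNIV. \<forall>x\<in>span {c1, c2}. orthogonal x y} + dim (span {c1, c2}) = dim (UNIV :: (real ^ 'm) set)"
    by (rule dim_subspace_orthogonal_to_vectors) auto
  moreover have "(\<forall>x\<in>span {c1, c2}. orthogonal x y) \<longleftrightarrow> c1 \<bullet> y = 0 \<and> c2 \<bullet> y = 0" for y
  proof -
    have "orthogonal x y" if "x \<in> span {c1, c2}" "c1 \<bullet> y = 0" "c2 \<bullet> y = 0" for x
      using orthogonal_to_span[OF that(1), of y] that(2,3)
      by (auto simp: orthogonal_def inner_commute)
    then show ?thesis
      by (meson insertI1 insertI2 orthogonal_def span_base)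
  qed
  ultimately show ?thesis using two card by (simp add: eigenspace_u)
qed

text \<open>The two acoustic eigenvectors \<open>b1 \<plusminus> \<beta> b2\<close> span the same plane as \<open>b1\<close> and \<open>b2\<close>, which is a
  complement of the kernel of \<open>K\<close>: subtracting suitable multiples of \<open>b1\<close> and \<open>b2\<close> brings any vector
  into the kernel.\<close>

lemma eigenvector_basis:
  "\<exists>B. independent B \<and> span B = UNIV \<and> (\<forall>r\<in>B. \<exists>l. r \<in> eigenspace A F U N l)"
proof -
  define s where "s = sqrt \<kappa>"
  \<comment> \<open>The eigenvector equation for \<open>b1 + \<beta> b2\<close> and eigenvalue \<open>s\<close> of \<open>K\<close> reads \<open>\<beta> (c1 \<bullet> b2) = s\<close> and \<open>c2 \<bullet> b1 = \<beta> s\<close>.\<close>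
  define \<beta> where "\<beta> = s / (c1 \<bullet> b2)"
  have s: "s\<^sup>2 = \<kappa>" "s \<noteq> 0" using \<kappa>_pos by (auto simp: s_def)
  have \<beta>: "\<beta> * (c1 \<bullet> b2) = s" "\<beta> * s = c2 \<bullet> b1" "\<beta> \<noteq> 0"
    using dots_nonzero s \<kappa> by (auto simp: \<beta>_def field_simps power2_eq_square)
  let ?S = "insert (b1 + \<beta> *\<^sub>R b2) (insert (b1 - \<beta> *\<^sub>R b2) (eigenspace A F U N u))"
  have "b1 + \<beta> *\<^sub>R b2 \<in> eigenspace A F U N (u + s)"
    using c1_b1 c2_b2 \<beta> unfolding eigenspace_eq
    by (simp add: inner_add_right algebra_simps)
  moreover have "b1 - \<beta> *\<^sub>R b2 \<in> eigenspace A F U N (u - s)"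
    using c1_b1 c2_b2 \<beta> unfolding eigenspace_eq
    by (simp add: inner_diff_right algebra_simps)
  ultimately have eig: "\<exists>l. r \<in> eigenspace A F U N l" if "r \<in> ?S" for r
    using that by blast
  have "b1 = (1/2) *\<^sub>R ((b1 + \<beta> *\<^sub>R b2) + (b1 - \<beta> *\<^sub>R b2))"
    by (simp add: scaleR_2[symmetric])
  also have "\<dots> \<in> span ?S"
    by (intro span_scale span_add span_base) auto
  finally have b1: "b1 \<in> span ?S" .
  have "b2 = (1/\<beta>) *\<^sub>R ((b1 + \<beta> *\<^sub>R b2) - b1)"
    using \<beta> by simp
  also have "\<dots> \<in> span ?S"
    by (intro span_scale span_diff b1) (auto intro: span_base)
  finally have b2: "b2 \<in> span ?S" .
  have "x \<in> span ?S" for x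
  proof -
    let ?y = "((c1 \<bullet> x) / (c1 \<bullet> b2)) *\<^sub>R b2 + ((c2 \<bullet> x) / (c2 \<bullet> b1)) *\<^sub>R b1"
    have "x - ?y \<in> eigenspace A F U N u"
      using c1_b1 c2_b2 dots_nonzero by (simp add: eigenspace_u inner_diff_right inner_add_right)
    then have "x - ?y \<in> span ?S" by (intro span_base) auto
    moreover have "?y \<in> span ?S"
      by (intro span_add span_scale b1 b2)
    ultimately show ?thesis
      using span_add by fastforce
  qed
  moreover obtain B where "B \<subseteq> ?S" "independent B" "?S \<subseteq> span B"
    using maximal_independent_subset[of ?S] by blast
  moreover then have "span ?S \<subseteq> span B"
    by (simp add: span_minimal)
  ultimately show ?thesis using eig by blast
qed

lemma is_eigenvalue_iff:
  assumes "d > 0"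
  shows "is_eigenvalue A F U N l \<longleftrightarrow>
    l = of_real u \<or> l = of_real (u + sqrt \<kappa>) \<or> l = of_real (u - sqrt \<kappa>)"
proof -
  have "is_eigenvalue A F U N l \<longleftrightarrow> det (pencil A F U N l) = 0"
    by (simp add: is_eigenvalue_def det_eq_0_iff_kernel)
  also have "\<dots> \<longleftrightarrow> l = of_real u \<or> (of_real u - l)\<^sup>2 = of_real \<kappa>"
    using det_A assms by (auto simp: det_pencil)
  also have "(complex_of_real \<kappa>) = (of_real (sqrt \<kappa>))\<^sup>2"
    using \<kappa>_pos by (simp flip: of_real_power)
  finally show ?thesis
    by (auto simp: power2_eq_iff algebra_simps)
qed

end

section \<open>Derivatives of the thermodynamic functions\<close>

lemma dir_deriv_eq:
  assumes "(f has_derivative f') (at x)"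
  shows "dir_deriv f d x = f' d"
proof -
  have "((\<lambda>s. x + s *\<^sub>R d) has_derivative (\<lambda>s. s *\<^sub>R d)) (at 0)"
    by (auto intro!: derivative_eq_intros)
  moreover have "(f has_derivative f') (at (x + 0 *\<^sub>R d))" using assms by simp
  ultimately have "((\<lambda>s. f (x + s *\<^sub>R d)) has_derivative (\<lambda>s. f' (s *\<^sub>R d))) (at 0)"
    by (rule has_derivative_compose)
  then have "((\<lambda>s. f (x + s *\<^sub>R d)) has_vector_derivative f' d) (at 0)"
    using has_derivative_linear[OF assms] by (simp add: has_vector_derivative_def linear_scale)
  then show ?thesis
    by (simp add: dir_deriv_def vector_derivative_at)
qed

text \<open>On the open set \<open>D\<close> the iterated directional derivatives are values of Frechet derivatives, so that
  the partial derivatives of the thermodynamic functions can be computed by the \<open>has_derivative\<close> calculus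
  and Schwarz's theorem applies to them.\<close>

lemma Ck_on_2_dir_deriv:
  fixes f :: "'a::euclidean_space \<Rightarrow> real"
  assumes "open D" and C2: "Ck_on 2 D f" and x: "x \<in> D"
  shows "(f has_derivative (\<lambda>d. dir_deriv f d x)) (at x)"
    and "(dir_deriv f e has_derivative (\<lambda>d. dir_deriv (dir_deriv f e) d x)) (at x)"
    and "dir_deriv (dir_deriv f e) d x = dir_deriv (dir_deriv f d) e x"
proof -
  note der = Ck_on_2_derivatives[OF C2]
  have eq: "dir_deriv f d y = frechet_derivative f (at y) d" if "y \<in> D" for d y
    by (rule dir_deriv_eq[OF der(1)[OF that]])
  show "(f has_derivative (\<lambda>d. dir_deriv f d x)) (at x)"
    using der(1)[OF x] by (simp add: eq x)
  have 2: "(dir_deriv f e has_derivative frechet_derivative (\<lambda>y. frechet_derivative f (at y) e) (at x)) (at x)" for e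
    by (rule has_derivative_transform_within_open[OF der(2)[OF x] \<open>open D\<close> x]) (simp add: eq)
  then show "(dir_deriv f e has_derivative (\<lambda>d. dir_deriv (dir_deriv f e) d x)) (at x)"
    by (simp add: dir_deriv_eq[OF 2])
  show "dir_deriv (dir_deriv f e) d x = dir_deriv (dir_deriv f d) e x"
    by (simp add: dir_deriv_eq[OF 2] Ck_on_2_mixed_derivatives_commute[OF assms])
qed

lemma linear_density_expansion:
  fixes L :: "(real ^ 'n) \<times> real \<Rightarrow> real"
  assumes "linear L"
  shows "L (r, s) = (\<Sum>i\<in>UNIV. r $ i * L (axis i 1, 0)) + s * L (0, 1)"
proof -
  have "(r, s) = (\<Sum>i\<in>UNIV. r $ i *\<^sub>R (axis i 1, 0)) + s *\<^sub>R (0, 1)"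
    by (simp add: prod_eq_iff fst_sum snd_sum vec_eq_iff axis_def if_distrib[of "\<lambda>x. _ * x"] cong: if_cong)
  also have "L \<dots> = (\<Sum>i\<in>UNIV. r $ i * L (axis i 1, 0)) + s * L (0, 1)"
    by (simp only: linear_add[OF assms] linear_sum[OF assms] linear_scale[OF assms] real_scaleR_def)
  finally show ?thesis .
qed

text \<open>The thermodynamics behind the spectrum: the Gibbs-Duhem relation
  \<open>\<Sum>\<^sub>i \<rho>\<^sub>i (\<rho>e)\<^bsub>\<rho>\<^sub>i\<^esub> = \<rho>e + p - \<theta> p\<^sub>\<theta>\<close>, \<open>\<rho> c\<^sub>v\<close> as the \<open>\<theta>\<close>-derivative of \<open>\<rho>e\<close>, and
  \<open>\<Sum>\<^sub>j \<rho>\<^sub>j p\<^bsub>\<rho>\<^sub>j\<^esub>\<close> as the quadratic form of the Hessian of \<open>\<rho>\<psi>\<close>. The first one needs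
  \<open>(\<rho>\<psi>)\<^bsub>\<theta>\<rho>\<^sub>i\<^esub> = (\<rho>\<psi>)\<^bsub>\<rho>\<^sub>i\<theta>\<^esub>\<close>: one side comes from differentiating the entropy in \<open>\<rho>\<^sub>i\<close>, the other from
  differentiating \<open>\<mu>\<^sub>i\<close> in \<open>\<theta>\<close>.\<close>

lemma mixture_derivatives:
  fixes \<Psi> :: "(real ^ 'n::finite) \<times> real \<Rightarrow> real"
  assumes D: "open D" "Ck_on 2 D \<Psi>" "(r, \<theta>) \<in> D" and mass: "mass r \<noteq> 0"
  obtains E' p' where "(int_energy \<Psi> has_derivative E') (at (r, \<theta>))"
    and "(pressure \<Psi> has_derivative p') (at (r, \<theta>))"
    and "E' (r, 0) = int_energy \<Psi> (r, \<theta>) + pressure \<Psi> (r, \<theta>) - \<theta> * p' (0, 1)"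
    and "E' (0, 1) = mass r * heat_capacity \<Psi> (r, \<theta>)"
    and "p' (r, 0) = r \<bullet> (rho_hessian \<Psi> (r, \<theta>) *v r)"
proof -
  let ?x = "(r, \<theta>)"
  note der = Ck_on_2_dir_deriv[OF D]
  define G where "G d = dir_deriv \<Psi> d ?x" for d
  define H where "H e d = dir_deriv (dir_deriv \<Psi> e) d ?x" for d e
  have G: "(\<Psi> has_derivative G) (at ?x)"
    using der(1) by (simp add: G_def[abs_def])
  have H: "(dir_deriv \<Psi> e has_derivative H e) (at ?x)" for e
    using der(2) by (simp add: H_def[abs_def])
  have sym: "H e d = H d e" for d e
    unfolding H_def by (rule der(3))
  have lin: "linear G" "linear (H e)" for e
    using has_derivative_linear[OF G] has_derivative_linear[OF H] by auto
  define E' where "E' h = G h - (H (0, 1) h * \<theta> + G (0, 1) * snd h)" for h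
  define p' where "p' h = (\<Sum>i\<in>UNIV. r $ i * H (axis i 1, 0) h + fst h $ i * G (axis i 1, 0)) - G h" for h
  have intE: "int_energy \<Psi> = (\<lambda>x. \<Psi> x - dir_deriv \<Psi> (0, 1) x * snd x)"
    by (simp add: int_energy_def entropy_def d_theta_def fun_eq_iff)
  have pr: "pressure \<Psi> = (\<lambda>x. (\<Sum>i\<in>UNIV. fst x $ i * dir_deriv \<Psi> (axis i 1, 0) x) - \<Psi> x)"
    by (simp add: pressure_def chem_pot_def d_rho_def fun_eq_iff)
  have E: "(int_energy \<Psi> has_derivative E') (at ?x)"
    unfolding intE
    by (rule derivative_eq_intros G H refl)+ (simp add: E'_def fun_eq_iff G_def)
  have p: "(pressure \<Psi> has_derivative p') (at ?x)"
    unfolding pr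
    by (rule derivative_eq_intros G H refl bounded_linear.has_derivative[OF bounded_linear_vec_nth])+
      (simp add: p'_def fun_eq_iff G_def)
  have GH0: "G (r, 0) = (\<Sum>i\<in>UNIV. r $ i * G (axis i 1, 0))"
    "H e (r, 0) = (\<Sum>i\<in>UNIV. r $ i * H e (axis i 1, 0))" for e
    using linear_density_expansion[OF lin(1), of r 0] linear_density_expansion[OF lin(2), of e r 0]
    by simp_all
  have 1: "E' (r, 0) = int_energy \<Psi> ?x + pressure \<Psi> ?x - \<theta> * p' (0, 1)"
    by (simp add: E'_def p'_def intE pr GH0 sym[of "(0, 1)"] G_def[symmetric] algebra_simps)
  have "(spec_int_energy \<Psi> has_derivative
      (\<lambda>h. (E' h * mass r - int_energy \<Psi> ?x * mass (fst h)) / (mass r * mass r))) (at ?x)"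
  proof -
    have "(mass has_derivative mass) (at r)"
      unfolding mass_def[abs_def]
      by (intro bounded_linear_imp_has_derivative bounded_linear_sum bounded_linear_vec_nth)
    from has_derivative_compose[OF has_derivative_fst[OF has_derivative_ident], of mass mass ?x UNIV]
    have "((\<lambda>x. mass (fst x)) has_derivative (\<lambda>h. mass (fst h))) (at ?x)"
      using \<open>(mass has_derivative mass) (at r)\<close> by simp
    from has_derivative_divide'[OF E this] show ?thesis
      using mass by (simp add: spec_int_energy_def[abs_def])
  qed
  then have "heat_capacity \<Psi> ?x = (E' (0, 1) * mass r - int_energy \<Psi> ?x * mass (0 :: real ^ 'n)) / (mass r * mass r)"
    by (simp add: heat_capacity_def d_theta_def dir_deriv_eq)
  then have 2: "E' (0, 1) = mass r * heat_capacity \<Psi> ?x"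
    using mass by (simp add: mass_def)
  have hess: "rho_hessian \<Psi> ?x $ i $ j = H (axis i 1, 0) (axis j 1, 0)" for i j
    by (simp add: rho_hessian_def d_rho_def H_def)
  have 3: "p' (r, 0) = r \<bullet> (rho_hessian \<Psi> ?x *v r)"
    by (simp add: p'_def GH0 sum.distrib inner_vec_def matrix_vector_mult_def hess mult.commute)
  show thesis by (rule that[OF E p 1 2 3])
qed

section \<open>Differentials of the conserved quantities and fluxes\<close>

lemma state_eqI: "U = V" if "dens U = dens V" "vel U = vel V" "temp U = temp V"
  for U V :: "'n::finite state"
proof -
  have "U $ a = V $ a" for a
  proof (cases a)
    case (Inl i)
    then show ?thesis using that(1) by (simp add: dens_def vec_eq_iff)
  next
    case (Inr b)
    then show ?thesis using that(2,3) by (cases b) (simp_all add: vel_def temp_def vec_eq_iff)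
  qed
  then show ?thesis by (simp add: vec_eq_iff)
qed

lemma stack_nth [simp]:
  "stack r w s $ Inl i = r $ i" "stack r w s $ Inr (Inl k) = w $ k" "stack r w s $ Inr (Inr c) = s"
  by (simp_all add: stack_def)

lemma components_stack [simp]:
  "dens (stack r w s) = r" "vel (stack r w s) = w" "temp (stack r w s) = s"
  by (simp_all add: dens_def vel_def temp_def vec_eq_iff)

lemma linear_components: "linear dens" "linear vel" "linear temp" "linear thermo" "linear mass"
  by (auto intro!: linearI simp: dens_def vel_def temp_def thermo_def mass_def vec_eq_iff
      sum.distrib sum_distrib_left)

lemmas components_simps =
  linear_components(1-3)[THEN linear_add] linear_components(1-3)[THEN linear_scale]

lemmas has_derivative_components =
  linear_components[unfolded linear_conv_bounded_linear, THEN bounded_linear.has_derivative]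

lemma has_derivative_stack:
  assumes "(f has_derivative f') (at x within S)" "(g has_derivative g') (at x within S)"
    "(h has_derivative h') (at x within S)"
  shows "((\<lambda>x. stack (f x) (g x) (h x)) has_derivative (\<lambda>y. stack (f' y) (g' y) (h' y)))
    (at x within S)"
proof -
  have "linear (\<lambda>(r, w, s). stack r w s)"
    by (auto intro!: linearI state_eqI simp: components_simps)
  then have "bounded_linear (\<lambda>(r, w, s). stack r w s)"
    by (simp add: linear_conv_bounded_linear)
  from bounded_linear.has_derivative[OF this has_derivative_Pair[OF assms(1) has_derivative_Pair[OF assms(2,3)]]]
  show ?thesis by simp
qed

lemma UNIV_state:
  "(UNIV :: ('n::finite + (3 + unit)) set) = range Inl \<union> (range (Inr \<circ> Inl) \<union> {Inr (Inr ())})"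
proof -
  have "a \<in> range Inl \<union> (range (Inr \<circ> Inl) \<union> {Inr (Inr ())})" for a :: "'n + (3 + unit)"
    by (cases a rule: sum.exhaust; simp) (metis UNIV_unit UNIV_I comp_apply insertE empty_iff old.sum.exhaust rangeI)
  then show ?thesis by blast
qed

lemma inner_stack: "stack r w s \<bullet> U = r \<bullet> dens U + w \<bullet> vel U + s * temp U"
  for U :: "'n::finite state"
proof -
  have "(\<Sum>a\<in>UNIV. stack r w s $ a * U $ a)
      = (\<Sum>i\<in>UNIV. r $ i * U $ Inl i) + ((\<Sum>k\<in>UNIV. w $ k * U $ Inr (Inl k)) + s * U $ Inr (Inr ()))"
    unfolding UNIV_state
    by (subst sum.union_disjoint; (subst sum.union_disjoint)?) (auto simp: sum.reindex inj_on_def)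
  then show ?thesis
    by (simp add: inner_vec_def dens_def vel_def temp_def)
qed

lemma prod_state: "(\<Prod>a\<in>UNIV. f a)
    = (\<Prod>i\<in>UNIV. f (Inl i)) * ((\<Prod>k\<in>UNIV. f (Inr (Inl k))) * f (Inr (Inr ())))"
  for f :: "'n::finite + (3 + unit) \<Rightarrow> real"
  unfolding UNIV_state
    by (subst prod.union_disjoint; (subst prod.union_disjoint)?) (auto simp: prod.reindex inj_on_def)

lemma axis_nth_if: "axis k x $ i = (if i = k then x else 0)"
  by (simp add: axis_def)

lemma components_axis [simp]:
  "dens (axis (Inl i) 1) = axis i 1" "vel (axis (Inl i) 1) = 0" "temp (axis (Inl i) 1) = 0"
  "dens (axis (Inr b) 1) = 0" 
  "vel (axis (Inr (Inl k)) 1) = axis k 1" "temp (axis (Inr (Inl k)) 1) = 0"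
  "vel (axis (Inr (Inr c)) 1) = 0" "temp (axis (Inr (Inr c)) 1) = 1"
  by (simp_all add: dens_def vel_def temp_def vec_eq_iff axis_def)

text \<open>The differentials of \<open>A_map\<close> and \<open>F_map\<close> at \<open>U\<close> in the direction \<open>r\<close>, where \<open>E'\<close> and \<open>p'\<close> stand for
  the differentials of \<open>\<rho>e\<close> and \<open>p\<close>. Keeping these abstract separates the kinematics from the equation
  of state.\<close>

definition A_deriv :: "((real ^ 'n) \<times> real \<Rightarrow> real) \<Rightarrow> 'n::finite state \<Rightarrow> 'n state \<Rightarrow> 'n state" where
  "A_deriv E' U r = stack (dens r)
     (mass (dens r) *\<^sub>R vel U + mass (dens U) *\<^sub>R vel r)
     (E' (thermo r) + 1 / 2 * mass (dens r) * (norm (vel U))\<^sup>2 + mass (dens U) * (vel U \<bullet> vel r))"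

definition F_deriv ::
  "((real ^ 'n) \<times> real \<Rightarrow> real) \<Rightarrow> ((real ^ 'n) \<times> real \<Rightarrow> real) \<Rightarrow> ((real ^ 'n) \<times> real \<Rightarrow> real)
    \<Rightarrow> 'n::finite state \<Rightarrow> 3 \<Rightarrow> 'n state \<Rightarrow> 'n state" where
  "F_deriv \<Psi> E' p' U \<alpha> r = stack
     (vel U $ \<alpha> *\<^sub>R dens r + vel r $ \<alpha> *\<^sub>R dens U)
     (vel U $ \<alpha> *\<^sub>R (mass (dens r) *\<^sub>R vel U + mass (dens U) *\<^sub>R vel r)
        + (vel r $ \<alpha> * mass (dens U)) *\<^sub>R vel U + p' (thermo r) *\<^sub>R axis \<alpha> 1)
     (vel U $ \<alpha> * (temp (A_deriv E' U r) + p' (thermo r))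
        + vel r $ \<alpha> * (total_energy \<Psi> U + pressure \<Psi> (thermo U)))"

context
  fixes \<Psi> :: "(real ^ 'n::finite) \<times> real \<Rightarrow> real" and U :: "'n state" and E' p'
  assumes E': "(int_energy \<Psi> has_derivative E') (at (thermo U))"
    and p': "(pressure \<Psi> has_derivative p') (at (thermo U))"
begin

lemma total_energy_has_derivative:
  "(total_energy \<Psi> has_derivative (\<lambda>r. temp (A_deriv E' U r))) (at U)"
proof -
  have "((\<lambda>V. int_energy \<Psi> (thermo V)) has_derivative (\<lambda>r. E' (thermo r))) (at U)"
    by (rule has_derivative_compose[OF has_derivative_components(4)[OF has_derivative_ident] E'])
  then have "((\<lambda>V. int_energy \<Psi> (thermo V) + 1 / 2 * mass (dens V) * (vel V \<bullet> vel V)) has_derivative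
      (\<lambda>r. E' (thermo r) + (1 / 2 * mass (dens U) * (vel U \<bullet> vel r + vel r \<bullet> vel U)
         + 1 / 2 * mass (dens r) * (vel U \<bullet> vel U)))) (at U)"
    by (auto intro!: derivative_eq_intros has_derivative_components simp: algebra_simps)
  then show ?thesis
    by (simp add: total_energy_def[abs_def] A_deriv_def power2_norm_eq_inner inner_commute algebra_simps)
qed

lemma A_map_has_derivative: "(A_map \<Psi> has_derivative A_deriv E' U) (at U)"
proof -
  have "(A_map \<Psi> has_derivative
      (\<lambda>r. stack (dens r) (mass (dens U) *\<^sub>R vel r + mass (dens r) *\<^sub>R vel U) (temp (A_deriv E' U r)))) (at U)"
    unfolding A_map_def[abs_def]
    by (intro has_derivative_stack total_energy_has_derivative has_derivative_scaleR
        has_derivative_components has_derivative_ident)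
  then show ?thesis
    by (simp add: A_deriv_def[abs_def] add.commute)
qed

lemma F_map_has_derivative: "(F_map \<Psi> \<alpha> has_derivative F_deriv \<Psi> E' p' U \<alpha>) (at U)"
proof -
  have p: "((\<lambda>V. pressure \<Psi> (thermo V)) has_derivative (\<lambda>r. p' (thermo r))) (at U)"
    by (rule has_derivative_compose[OF has_derivative_components(4)[OF has_derivative_ident] p'])
  have v: "((\<lambda>V. vel V $ \<alpha>) has_derivative (\<lambda>r. vel r $ \<alpha>)) (at U)"
    by (intro bounded_linear.has_derivative[OF bounded_linear_vec_nth] has_derivative_components
        has_derivative_ident)
  have F: "F_map \<Psi> \<alpha> = (\<lambda>V. stack (vel V $ \<alpha> *\<^sub>R dens V)
      ((vel V $ \<alpha> * mass (dens V)) *\<^sub>R vel V + pressure \<Psi> (thermo V) *\<^sub>R axis \<alpha> 1)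
      (vel V $ \<alpha> * (total_energy \<Psi> V + pressure \<Psi> (thermo V))))"
    by (rule ext, rule state_eqI)
      (simp_all add: F_map_def vec_eq_iff kdelta_def axis_nth_if mult_ac)
  have "(F_map \<Psi> \<alpha> has_derivative (\<lambda>r. stack
      (vel U $ \<alpha> *\<^sub>R dens r + vel r $ \<alpha> *\<^sub>R dens U)
      ((vel U $ \<alpha> * mass (dens U)) *\<^sub>R vel r
        + (vel U $ \<alpha> * mass (dens r) + vel r $ \<alpha> * mass (dens U)) *\<^sub>R vel U + p' (thermo r) *\<^sub>R axis \<alpha> 1)
      (vel U $ \<alpha> * (temp (A_deriv E' U r) + p' (thermo r))
        + vel r $ \<alpha> * (total_energy \<Psi> U + pressure \<Psi> (thermo U))))) (at U)"
    unfolding F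
    by (intro has_derivative_stack total_energy_has_derivative has_derivative_scaleR has_derivative_mult
        has_derivative_components has_derivative_ident has_derivative_add p v has_derivative_scaleR_left)
  then show ?thesis
    by (simp add: F_deriv_def[abs_def] algebra_simps)
qed

lemma jacobian_A_map: "jacobian (A_map \<Psi>) (at U) *v r = A_deriv E' U r"
  using A_map_has_derivative frechet_derivative_at[OF A_map_has_derivative]
  by (simp add: jacobian_def has_derivative_linear)

lemma jacobian_F_map: "jacobian (F_map \<Psi> \<alpha>) (at U) *v r = F_deriv \<Psi> E' p' U \<alpha> r"
  using has_derivative_linear[OF F_map_has_derivative[of \<alpha>]]
    frechet_derivative_at[OF F_map_has_derivative[of \<alpha>]]
  by (simp add: jacobian_def)

text \<open>With densities first, then velocities, then temperature, the Jacobian is lower triangular: the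
  density entries of \<open>A\<close> involve only densities and the momentum entries do not involve \<open>\<theta>\<close>.\<close>

lemma det_jacobian_A_map: "det (jacobian (A_map \<Psi>) (at U)) = mass (dens U) ^ 3 * E' (0, 1)"
proof -
  let ?J = "jacobian (A_map \<Psi>) (at U)"
  define h :: "'n + (3 + unit) \<Rightarrow> nat" where
    "h a = (case a of Inl i \<Rightarrow> 0 | Inr (Inl k) \<Rightarrow> 1 | Inr (Inr _) \<Rightarrow> 2)" for a
  have lin: "linear E'" using E' by (rule has_derivative_linear)
  have J: "?J $ a $ b = A_deriv E' U (axis b 1) $ a" for a b
    by (simp add: jacobian_A_map[symmetric] matrix_vector_mult_basis column_def)
  have "a = b \<or> h b < h a" if "?J $ a $ b \<noteq> 0" for a b
    using that unfolding J
    by (cases a; cases b) (auto simp: A_deriv_def h_def thermo_def axis_nth_if mass_def linear_0[OF lin] zero_prod_def[symmetric]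
        split: if_splits sum.splits)
  then have "det ?J = (\<Prod>a\<in>UNIV. ?J $ a $ a)"
    by (rule det_triangular_height)
  then show ?thesis
    by (simp add: prod_state J A_deriv_def thermo_def mass_def)
qed

text \<open>The fluxes are \<open>F\<^sub>\<alpha> = v\<^sub>\<alpha> A + p (0, e\<^sub>\<alpha>, v\<^sub>\<alpha>)\<close> with \<open>e\<^sub>\<alpha>\<close> the unit vector, so the differential of
  \<open>\<Sum>\<^sub>\<alpha> N\<^sub>\<alpha> F\<^sub>\<alpha>\<close> is \<open>v \<bullet> N\<close> times that of \<open>A\<close>, up to a term depending only on \<open>\<delta>v \<bullet> N\<close> and
  one depending only on \<open>\<delta>p\<close>. These terms have the directions \<open>(\<rho>\<^sub>i, \<rho>v, \<rho>e + \<rho>|v|\<^sup>2/2 + p)\<close> and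
  \<open>(0, N, v \<bullet> N)\<close>. The first vectors of the two outer products are their preimages under \<open>\<nabla>A\<close>, and
  the Gibbs-Duhem relation is what makes the temperature entry of the first preimage equal to \<open>\<theta> p\<^sub>\<theta> / (\<rho>e)\<^sub>\<theta>\<close>.\<close>

lemma normal_flux_factorization:
  assumes gibbs_duhem: "E' (dens U, 0)
      = int_energy \<Psi> (thermo U) + pressure \<Psi> (thermo U) - temp U * p' (0, 1)"
    and mass: "mass (dens U) \<noteq> 0" and heat: "E' (0, 1) \<noteq> 0"
  shows "normal_flux (F_map \<Psi>) U N = jacobian (A_map \<Psi>) (at U) **
    (mat (vel U \<bullet> N)
     + (outer (stack (dens U) 0 (temp U * p' (0, 1) / E' (0, 1))) (stack 0 N 0)
      + outer (stack 0 ((1 / mass (dens U)) *\<^sub>R N) 0) (stack (\<chi> i. p' (axis i 1, 0)) 0 (p' (0, 1)))))"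
    (is "?L = ?J ** (mat ?u + (outer ?b1 ?c1 + outer ?b2 ?c2))")
proof -
  have linE: "linear E'" using E' by (rule has_derivative_linear)
  have linp: "linear p'" using p' by (rule has_derivative_linear)
  have dot: "outer b c *v r = (c \<bullet> r) *\<^sub>R b" for b c r :: "'n state"
    by (simp add: outer_mult_vec inner_vec_def scalar_mult_eq_scaleR)
  have c1: "?c1 \<bullet> r = N \<bullet> vel r" for r
    by (simp add: inner_stack)
  have c2: "?c2 \<bullet> r = p' (thermo r)" for r
    using linear_density_expansion[OF linp, of "dens r" "temp r"]
    by (simp add: inner_stack thermo_def) (simp add: inner_vec_def mult.commute)
  have "E' (dens U, temp U * p' (0, 1) / E' (0, 1)) = E' (dens U, 0) + temp U * p' (0, 1)"
    using linear_density_expansion[OF linE, of "dens U" "temp U * p' (0, 1) / E' (0, 1)"]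
      linear_density_expansion[OF linE, of "dens U" 0] heat by simp
  then have Ab1: "?J *v ?b1 = stack (dens U) (mass (dens U) *\<^sub>R vel U)
      (total_energy \<Psi> U + pressure \<Psi> (thermo U))"
    by (simp add: jacobian_A_map A_deriv_def thermo_def[of "stack _ _ _"] gibbs_duhem total_energy_def add_ac)
  have Ab2: "?J *v ?b2 = stack 0 N (vel U \<bullet> N)"
    using mass by (simp add: jacobian_A_map A_deriv_def thermo_def mass_def linear_0[OF linE] zero_prod_def[symmetric])
  have "?L *v r = (?J ** (mat ?u + (outer ?b1 ?c1 + outer ?b2 ?c2))) *v r" for r
  proof -
    have "?L *v r = (\<Sum>\<alpha>\<in>UNIV. N $ \<alpha> *\<^sub>R F_deriv \<Psi> E' p' U \<alpha> r)"
      by (simp add: normal_flux_def sum_3 matrix_vector_mult_add_rdistrib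
          scaleR_matrix_vector_assoc[symmetric] jacobian_F_map)
    also have "\<dots> = ?u *\<^sub>R A_deriv E' U r
        + (N \<bullet> vel r) *\<^sub>R stack (dens U) (mass (dens U) *\<^sub>R vel U) (total_energy \<Psi> U + pressure \<Psi> (thermo U))
        + p' (thermo r) *\<^sub>R stack 0 N (vel U \<bullet> N)"
      by (rule state_eqI)
        (simp_all add: sum_3 components_simps F_deriv_def A_deriv_def inner_vec_def vec_eq_iff forall_3
          axis_nth_if algebra_simps)
    also have "\<dots> = ?J *v (?u *\<^sub>R r + ((?c1 \<bullet> r) *\<^sub>R ?b1 + (?c2 \<bullet> r) *\<^sub>R ?b2))"
      by (simp only: matrix_vector_right_distrib matrix_vector_mult_scaleR c1 c2
          Ab1[unfolded jacobian_A_map] Ab2[unfolded jacobian_A_map]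
          jacobian_A_map add.assoc)
    also have "\<dots> = (?J ** (mat ?u + (outer ?b1 ?c1 + outer ?b2 ?c2))) *v r"
      by (simp only: matrix_vector_mul_assoc[symmetric] matrix_vector_mult_add_rdistrib
          mat_mult_vec dot scalar_mult_eq_scaleR)
    finally show ?thesis .
  qed
  then show ?thesis by (simp add: matrix_eq)
qed

text \<open>The chain rule, entry by entry. In the energy balance the flux of \<open>F_map\<close> has the form
  \<open>(\<rho>e + \<rho>|v|\<^sup>2/2 + p) v\<close>, which differs from that of the balance law by distributivity only.\<close>

lemma balance_laws_iff_quasilinear:
  assumes W: "W differentiable (at z)" and Wz: "W z = U"
  shows "balance_laws_at \<Psi> W z \<longleftrightarrow> quasilinear_at (A_map \<Psi>) (F_map \<Psi>) W z"
proof -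
  obtain W' where W': "(W has_derivative W') (at z)"
    using W by (auto simp: differentiable_def)
  have chain: "dir_deriv (\<lambda>y. G (W y) $ a) e z = G' (dir_deriv W e z) $ a"
    if "(G has_derivative G') (at U)" for G :: "'n state \<Rightarrow> 'n state" and G' a e
  proof -
    have "((\<lambda>y. G (W y) $ a) has_derivative (\<lambda>h. G' (W' h) $ a)) (at z)"
      using has_derivative_compose[OF W', of G G'] that Wz
      by (intro bounded_linear.has_derivative[OF bounded_linear_vec_nth]) simp
    then show ?thesis by (simp add: dir_deriv_eq[OF W'] dir_deriv_eq)
  qed
  have "quasilinear_at (A_map \<Psi>) (F_map \<Psi>) W z \<longleftrightarrow>
      (\<forall>a. A_deriv E' U (d_t W z) $ a + (\<Sum>\<alpha>\<in>UNIV. F_deriv \<Psi> E' p' U \<alpha> (d_x \<alpha> W z) $ a) = 0)"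
    by (simp add: quasilinear_at_def Wz jacobian_A_map jacobian_F_map vec_eq_iff)
  also have "\<dots> \<longleftrightarrow> (\<forall>a. d_t (\<lambda>y. A_map \<Psi> (W y) $ a) z
      + (\<Sum>\<alpha>\<in>UNIV. d_x \<alpha> (\<lambda>y. F_map \<Psi> \<alpha> (W y) $ a) z) = 0)"
    by (simp add: d_t_def d_x_def chain[OF A_map_has_derivative] chain[OF F_map_has_derivative])
  also have "\<dots> \<longleftrightarrow> balance_laws_at \<Psi> W z"
    by (simp add: split_sum_all balance_laws_at_def A_map_def F_map_def distrib_right)
  finally show ?thesis by simp
qed

end

section \<open>Hyperbolicity of the multicomponent Euler system\<close>

theorem mainTheorem5:
  fixes \<Psi> :: "(real ^ 'n) \<times> real \<Rightarrow> real"
    and D :: "((real ^ 'n) \<times> real) set"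
    and U :: "('n::finite) state"
  assumes "open D"
    and "Ck_on 2 D \<Psi>"
    and "thermo U \<in> D"
    and "\<And>i. dens U $ i \<ge> 0"
    and "mass (dens U) > 0"
    and "temp U > 0"
    and "heat_capacity \<Psi> (thermo U) > 0"
    and "positive_definite (rho_hessian \<Psi> (thermo U))"
  shows
    "(\<forall>W z. W differentiable (at z) \<and> W z = U \<longrightarrow>
        (balance_laws_at \<Psi> W z \<longleftrightarrow> quasilinear_at (A_map \<Psi>) (F_map \<Psi>) W z)) \<and>
     hyperbolic_at (A_map \<Psi>) (F_map \<Psi>) U \<and>
     0 \<le> sound_speed_sq \<Psi> U \<and>
     (\<forall>N :: real ^ 3. norm N = 1 \<longrightarrow>
        (\<forall>l :: complex.
           det (pencil (A_map \<Psi>) (F_map \<Psi>) U N l) =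
             of_real ((mass (dens U)) ^ 4 * heat_capacity \<Psi> (thermo U))
             * (of_real (vel U \<bullet> N) - l) ^ (CARD('n) + 2)
             * ((of_real (vel U \<bullet> N) - l)\<^sup>2
                - of_real (1 / mass (dens U)
                           * (\<Sum>i\<in>UNIV. dens U $ i * d_rho i (pressure \<Psi>) (thermo U)))
                - of_real (temp U * (d_theta (pressure \<Psi>) (thermo U))\<^sup>2
                           / (heat_capacity \<Psi> (thermo U) * (mass (dens U))\<^sup>2)))) \<and>
        (\<forall>l :: complex.
           det (pencil (A_map \<Psi>) (F_map \<Psi>) U N l) =
             of_real ((mass (dens U)) ^ 4 * heat_capacity \<Psi> (thermo U))
             * (of_real (vel U \<bullet> N) - l) ^ (CARD('n) + 2)
             * (of_real (vel U \<bullet> N + sqrt (sound_speed_sq \<Psi> U)) - l)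
             * (of_real (vel U \<bullet> N - sqrt (sound_speed_sq \<Psi> U)) - l)) \<and>
        {l. is_eigenvalue (A_map \<Psi>) (F_map \<Psi>) U N l} =
          {of_real (vel U \<bullet> N),
           of_real (vel U \<bullet> N + sqrt (sound_speed_sq \<Psi> U)),
           of_real (vel U \<bullet> N - sqrt (sound_speed_sq \<Psi> U))} \<and>
        dim (eigenspace (A_map \<Psi>) (F_map \<Psi>) U N (vel U \<bullet> N)) = CARD('n) + 2)"
proof -
  let ?x = "thermo U" and ?m = "mass (dens U)" and ?cv = "heat_capacity \<Psi> (thermo U)"
  let ?\<kappa> = "sound_speed_sq \<Psi> U"
  have x: "?x = (dens U, temp U)" by (simp add: thermo_def)
  have m: "?m \<noteq> 0" using assms(5) by simp
  obtain E' p' where E': "(int_energy \<Psi> has_derivative E') (at ?x)"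
    and p': "(pressure \<Psi> has_derivative p') (at ?x)"
    and gibbs_duhem: "E' (dens U, 0) = int_energy \<Psi> ?x + pressure \<Psi> ?x - temp U * p' (0, 1)"
    and heat: "E' (0, 1) = ?m * ?cv"
    and quadratic: "p' (dens U, 0) = dens U \<bullet> (rho_hessian \<Psi> ?x *v dens U)"
    using mixture_derivatives[OF assms(1,2) assms(3)[unfolded x] m] unfolding x by blast
  have linp: "linear p'" using p' by (rule has_derivative_linear)
  have p_rho: "d_rho i (pressure \<Psi>) ?x = p' (axis i 1, 0)" for i
    by (simp add: d_rho_def dir_deriv_eq[OF p'])
  have p_theta: "d_theta (pressure \<Psi>) ?x = p' (0, 1)"
    by (simp add: d_theta_def dir_deriv_eq[OF p'])
  have p_dens: "(\<Sum>i\<in>UNIV. dens U $ i * d_rho i (pressure \<Psi>) ?x) = p' (dens U, 0)"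
    using linear_density_expansion[OF linp, of "dens U" 0] by (simp add: p_rho)
  have "dens U \<noteq> 0" using m by (auto simp: mass_def)
  then have "p' (dens U, 0) > 0"
    using assms(8) quadratic by (simp add: positive_definite_def)
  then have \<kappa>_pos: "?\<kappa> > 0"
    using assms(5-7) unfolding sound_speed_sq_def p_dens p_theta
    by (intro add_pos_nonneg mult_pos_pos divide_nonneg_pos mult_nonneg_nonneg) simp_all
  have detA: "det (jacobian (A_map \<Psi>) (at U)) = ?m ^ 4 * ?cv"
    unfolding det_jacobian_A_map[OF E' p'] heat by (simp add: eval_nat_numeral)
  have detA0: "det (jacobian (A_map \<Psi>) (at U)) \<noteq> 0"
    using detA m assms(7) by simp
  have flux: "rank_two_flux (A_map \<Psi>) (F_map \<Psi>) U N (vel U \<bullet> N) ?\<kappa>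
      (stack (dens U) 0 (temp U * p' (0, 1) / E' (0, 1))) (stack 0 ((1 / ?m) *\<^sub>R N) 0)
      (stack 0 N 0) (stack (\<chi> i. p' (axis i 1, 0)) 0 (p' (0, 1))) (CARD('n) + 2)"
    if N: "norm N = 1" for N
  proof
    have "N \<bullet> N = 1" using N by (simp add: dot_square_norm)
    moreover have "(\<chi> i. p' (axis i 1, 0)) \<bullet> dens U = p' (dens U, 0)"
      by (simp add: p_dens[symmetric] p_rho inner_vec_def mult.commute)
    ultimately show "(stack 0 N 0 \<bullet> stack 0 ((1 / ?m) *\<^sub>R N) 0) *
        (stack (\<chi> i. p' (axis i 1, 0)) 0 (p' (0, 1)) \<bullet>
          stack (dens U) 0 (temp U * p' (0, 1) / E' (0, 1))) = ?\<kappa>"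
      using m assms(7) unfolding sound_speed_sq_def p_dens p_theta heat
      by (simp add: inner_stack field_simps power2_eq_square)
  qed (use detA0 \<kappa>_pos normal_flux_factorization[OF E' p' gibbs_duhem m] heat m assms(7)
      in \<open>simp_all add: inner_stack\<close>)
  have roots: "(z - l)\<^sup>2 - of_real a - of_real b = (z - l)\<^sup>2 - of_real (a + b)" for z l :: complex and a b
    by simp
  have factors: "(of_real s - l)\<^sup>2 - of_real ?\<kappa>
      = (of_real (s + sqrt ?\<kappa>) - l) * (of_real (s - sqrt ?\<kappa>) - l)" for s and l :: complex
  proof -
    have "of_real ?\<kappa> = complex_of_real (sqrt ?\<kappa>) * of_real (sqrt ?\<kappa>)"
      using \<kappa>_pos by (simp flip: of_real_mult)
    then show ?thesis by (simp add: power2_eq_square algebra_simps)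
  qed
  have hyperbolic: "hyperbolic_at (A_map \<Psi>) (F_map \<Psi>) U"
    unfolding hyperbolic_at_def
  proof (intro conjI allI impI)
    show "invertible (jacobian (A_map \<Psi>) (at U))"
      using detA0 by (simp add: invertible_det_nz)
  next
    fix N :: "real ^ 3" and l assume "norm N = 1" "is_eigenvalue (A_map \<Psi>) (F_map \<Psi>) U N l"
    then show "l \<in> \<real>"
      using rank_two_flux.is_eigenvalue_iff[OF flux] by (auto simp del: of_real_add of_real_diff)
  next
    fix N :: "real ^ 3" assume "norm N = 1"
    then show "\<exists>B. independent B \<and> span B = UNIV
        \<and> (\<forall>r\<in>B. \<exists>l. r \<in> eigenspace (A_map \<Psi>) (F_map \<Psi>) U N l)"
      by (rule rank_two_flux.eigenvector_basis[OF flux])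
  qed
  show ?thesis
  proof (intro conjI allI impI)
    fix W :: "real \<times> (real ^ 3) \<Rightarrow> 'n state" and z
    assume "W differentiable (at z) \<and> W z = U"
    then show "balance_laws_at \<Psi> W z \<longleftrightarrow> quasilinear_at (A_map \<Psi>) (F_map \<Psi>) W z"
      using balance_laws_iff_quasilinear[OF E' p'] by blast
  next
    show "hyperbolic_at (A_map \<Psi>) (F_map \<Psi>) U" by (rule hyperbolic)
    show "0 \<le> ?\<kappa>" using \<kappa>_pos by simp
  next
    fix N :: "real ^ 3" and l :: complex
    assume N: "norm N = 1"
    interpret rank_two_flux "A_map \<Psi>" "F_map \<Psi>" U N "vel U \<bullet> N" ?\<kappa>
      "stack (dens U) 0 (temp U * p' (0, 1) / E' (0, 1))" "stack 0 ((1 / ?m) *\<^sub>R N) 0"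
      "stack 0 N 0" "stack (\<chi> i. p' (axis i 1, 0)) 0 (p' (0, 1))" "CARD('n) + 2"
      by (rule flux[OF N])
    show "det (pencil (A_map \<Psi>) (F_map \<Psi>) U N l) =
        of_real (?m ^ 4 * ?cv) * (of_real (vel U \<bullet> N) - l) ^ (CARD('n) + 2)
        * ((of_real (vel U \<bullet> N) - l)\<^sup>2
           - of_real (1 / ?m * (\<Sum>i\<in>UNIV. dens U $ i * d_rho i (pressure \<Psi>) ?x))
           - of_real (temp U * (d_theta (pressure \<Psi>) ?x)\<^sup>2 / (?cv * ?m\<^sup>2)))"
      unfolding roots by (simp only: det_pencil detA sound_speed_sq_def)
    show "det (pencil (A_map \<Psi>) (F_map \<Psi>) U N l) =
        of_real (?m ^ 4 * ?cv) * (of_real (vel U \<bullet> N) - l) ^ (CARD('n) + 2)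
        * (of_real (vel U \<bullet> N + sqrt ?\<kappa>) - l) * (of_real (vel U \<bullet> N - sqrt ?\<kappa>) - l)"
      by (simp only: det_pencil detA factors mult.assoc)
  next
    fix N :: "real ^ 3"
    assume N: "norm N = 1"
    interpret rank_two_flux "A_map \<Psi>" "F_map \<Psi>" U N "vel U \<bullet> N" ?\<kappa>
      "stack (dens U) 0 (temp U * p' (0, 1) / E' (0, 1))" "stack 0 ((1 / ?m) *\<^sub>R N) 0"
      "stack 0 N 0" "stack (\<chi> i. p' (axis i 1, 0)) 0 (p' (0, 1))" "CARD('n) + 2"
      by (rule flux[OF N])
    show "{l. is_eigenvalue (A_map \<Psi>) (F_map \<Psi>) U N l} = {of_real (vel U \<bullet> N),
        of_real (vel U \<bullet> N + sqrt ?\<kappa>), of_real (vel U \<bullet> N - sqrt ?\<kappa>)}"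
    proof -
      have "CARD('n) + 2 > 0" by simp
      from is_eigenvalue_iff[OF this] show ?thesis by blast
    qed
    show "dim (eigenspace (A_map \<Psi>) (F_map \<Psi>) U N (vel U \<bullet> N)) = CARD('n) + 2"
      by (rule dim_eigenspace_u)
  qed
qed

end
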